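(* Let $G$ be the central product of normal subgroups $H,K$ ($G=HK$, $[H,K]=1$), $Z=H'\cap K'$, and $D$ a divisible abelian group with trivial action. Let $\theta':\operatorname{H}^2(G,D)\to \operatorname{H}^2(H,D)\oplus\operatorname{H}^2(K,D)\oplus\operatorname{Hom}(H\otimes K,D)$ be the homomorphism $\theta'=(\operatorname{res}^G_H,\operatorname{res}^G_K,\nu)$ defined in the context. Then there is an injective homomorphism $\chi:\operatorname{Hom}(Z,D)\to\operatorname{H}^2(G,D)$ such that the sequence $$0\to\operatorname{Hom}(Z,D)\xrightarrow{\chi}\operatorname{H}^2(G,D)\xrightarrow{\theta'}\operatorname{H}^2(H,D)\oplus\operatorname{H}^2(K,D)\oplus\operatorname{Hom}(H\otimes K,D)$$ is exact; in particular $\operatorname{Ker}(\theta')\cong\operatorname{Hom}(Z,D)$.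
   Context: $X\otimes Y$ denotes the abelian tensor product $X/X'\otimes_{\mathbb{Z}}Y/Y'$. For $\xi\in\operatorname{H}^2(G,D)$ represented by a 2-cocycle $f$ (values in $D$, written additively), $\nu(\xi)\in\operatorname{Hom}(H\otimes K,D)$ is given by $\nu(\xi)(hH'\otimes kK')=f(h,k)-f(k,h)$ for $h\in H$, $k\in K$. *)

theory Defs
  imports "HOL-Algebra.Algebra"
begin

text \<open>Everything is written multiplicatively in D (HOL-Algebra convention);
 the paper's additive notation f(h,k) - f(k,h) becomes f(h,k) * inv f(k,h).
 Cochains are extensional functions on carrier G x carrier G.\<close>

definition divisible_group :: "('d, 'e) monoid_scheme \<Rightarrow> bool" where
  "divisible_group D \<longleftrightarrow>
     (\<forall>x \<in> carrier D. \<forall>n::nat. n > 0 \<longrightarrow> (\<exists>y \<in> carrier D. y [^]\<^bsub>D\<^esub> n = x))"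

definition cocycles2 :: "('a, 'b) monoid_scheme \<Rightarrow> ('d, 'e) monoid_scheme \<Rightarrow> ('a \<times> 'a \<Rightarrow> 'd) set" where
  "cocycles2 G D = {f \<in> (carrier G \<times> carrier G) \<rightarrow>\<^sub>E carrier D.
      \<forall>x \<in> carrier G. \<forall>y \<in> carrier G. \<forall>z \<in> carrier G.
        f (y, z) \<otimes>\<^bsub>D\<^esub> f (x, y \<otimes>\<^bsub>G\<^esub> z) = f (x \<otimes>\<^bsub>G\<^esub> y, z) \<otimes>\<^bsub>D\<^esub> f (x, y)}"

definition coboundary :: "('a, 'b) monoid_scheme \<Rightarrow> ('d, 'e) monoid_scheme \<Rightarrow> ('a \<Rightarrow> 'd) \<Rightarrow> ('a \<times> 'a \<Rightarrow> 'd)" where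
  "coboundary G D \<phi> = (\<lambda>(x, y) \<in> carrier G \<times> carrier G.
      \<phi> y \<otimes>\<^bsub>D\<^esub> inv\<^bsub>D\<^esub> (\<phi> (x \<otimes>\<^bsub>G\<^esub> y)) \<otimes>\<^bsub>D\<^esub> \<phi> x)"

definition coboundaries2 :: "('a, 'b) monoid_scheme \<Rightarrow> ('d, 'e) monoid_scheme \<Rightarrow> ('a \<times> 'a \<Rightarrow> 'd) set" where
  "coboundaries2 G D = coboundary G D ` (carrier G \<rightarrow>\<^sub>E carrier D)"

definition cocycle_group :: "('a, 'b) monoid_scheme \<Rightarrow> ('d, 'e) monoid_scheme \<Rightarrow> ('a \<times> 'a \<Rightarrow> 'd) monoid" where
  "cocycle_group G D = \<lparr> carrier = cocycles2 G D,
      monoid.mult = (\<lambda>f g. \<lambda>p \<in> carrier G \<times> carrier G. f p \<otimes>\<^bsub>D\<^esub> g p),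
      monoid.one = (\<lambda>p \<in> carrier G \<times> carrier G. \<one>\<^bsub>D\<^esub>) \<rparr>"

definition H2 :: "('a, 'b) monoid_scheme \<Rightarrow> ('d, 'e) monoid_scheme \<Rightarrow> ('a \<times> 'a \<Rightarrow> 'd) set monoid" where
  "H2 G D = cocycle_group G D Mod coboundaries2 G D"

definition res2 :: "('a, 'b) monoid_scheme \<Rightarrow> 'a set \<Rightarrow> ('d, 'e) monoid_scheme
     \<Rightarrow> ('a \<times> 'a \<Rightarrow> 'd) set \<Rightarrow> ('a \<times> 'a \<Rightarrow> 'd) set" where
  "res2 G S D \<xi> = (\<Union>f \<in> \<xi>.
      coboundaries2 (G\<lparr>carrier := S\<rparr>) D #>\<^bsub>cocycle_group (G\<lparr>carrier := S\<rparr>) D\<^esub> restrict f (S \<times> S))"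

text \<open>Hom(H (x) K, D), with H (x) K = H/H' (x)_Z K/K', identified (universal property
 of the tensor product) with the group of bimultiplicative maps H x K -> D under
 pointwise multiplication (such maps automatically factor through H/H' x K/K'
 since D is abelian).\<close>
definition bilin_group :: "('a, 'b) monoid_scheme \<Rightarrow> 'a set \<Rightarrow> 'a set \<Rightarrow> ('d, 'e) monoid_scheme
     \<Rightarrow> ('a \<times> 'a \<Rightarrow> 'd) monoid" where
  "bilin_group G H K D = \<lparr> carrier = {\<beta> \<in> (H \<times> K) \<rightarrow>\<^sub>E carrier D.
        (\<forall>h1 \<in> H. \<forall>h2 \<in> H. \<forall>k \<in> K. \<beta> (h1 \<otimes>\<^bsub>G\<^esub> h2, k) = \<beta> (h1, k) \<otimes>\<^bsub>D\<^esub> \<beta> (h2, k)) \<and>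
        (\<forall>h \<in> H. \<forall>k1 \<in> K. \<forall>k2 \<in> K. \<beta> (h, k1 \<otimes>\<^bsub>G\<^esub> k2) = \<beta> (h, k1) \<otimes>\<^bsub>D\<^esub> \<beta> (h, k2))},
      monoid.mult = (\<lambda>\<alpha> \<beta>. \<lambda>p \<in> H \<times> K. \<alpha> p \<otimes>\<^bsub>D\<^esub> \<beta> p),
      monoid.one = (\<lambda>p \<in> H \<times> K. \<one>\<^bsub>D\<^esub>) \<rparr>"

definition nu :: "('a, 'b) monoid_scheme \<Rightarrow> 'a set \<Rightarrow> 'a set \<Rightarrow> ('d, 'e) monoid_scheme
     \<Rightarrow> ('a \<times> 'a \<Rightarrow> 'd) set \<Rightarrow> ('a \<times> 'a \<Rightarrow> 'd)" where
  "nu G H K D \<xi> = (let f = (SOME f. f \<in> \<xi>) in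
      (\<lambda>(h, k) \<in> H \<times> K. f (h, k) \<otimes>\<^bsub>D\<^esub> inv\<^bsub>D\<^esub> (f (k, h))))"

definition theta' :: "('a, 'b) monoid_scheme \<Rightarrow> 'a set \<Rightarrow> 'a set \<Rightarrow> ('d, 'e) monoid_scheme
     \<Rightarrow> ('a \<times> 'a \<Rightarrow> 'd) set \<Rightarrow> ('a \<times> 'a \<Rightarrow> 'd) set \<times> ('a \<times> 'a \<Rightarrow> 'd) set \<times> ('a \<times> 'a \<Rightarrow> 'd)" where
  "theta' G H K D \<xi> = (res2 G H D \<xi>, res2 G K D \<xi>, nu G H K D \<xi>)"

definition theta'_target :: "('a, 'b) monoid_scheme \<Rightarrow> 'a set \<Rightarrow> 'a set \<Rightarrow> ('d, 'e) monoid_scheme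
     \<Rightarrow> (('a \<times> 'a \<Rightarrow> 'd) set \<times> ('a \<times> 'a \<Rightarrow> 'd) set \<times> ('a \<times> 'a \<Rightarrow> 'd)) monoid" where
  "theta'_target G H K D =
     H2 (G\<lparr>carrier := H\<rparr>) D \<times>\<times> H2 (G\<lparr>carrier := K\<rparr>) D \<times>\<times> bilin_group G H K D"

definition hom_group :: "('a, 'b) monoid_scheme \<Rightarrow> 'a set \<Rightarrow> ('d, 'e) monoid_scheme \<Rightarrow> ('a \<Rightarrow> 'd) monoid" where
  "hom_group G Z D = \<lparr> carrier = hom (G\<lparr>carrier := Z\<rparr>) D \<inter> extensional Z,
      monoid.mult = (\<lambda>\<phi> \<psi>. \<lambda>z \<in> Z. \<phi> z \<otimes>\<^bsub>D\<^esub> \<psi> z),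
      monoid.one = (\<lambda>z \<in> Z. \<one>\<^bsub>D\<^esub>) \<rparr>"

end

theory Submission
  imports Defs
begin

text \<open>
  The subgroup \<open>A = H \<inter> K\<close> is central, and \<open>G\<close> is the quotient of \<open>H \<times> K\<close> by the copy
  \<open>{(a, a\<^sup>-\<^sup>1)}\<close> of \<open>A\<close>. Write every \<open>x\<close> as \<open>s x \<otimes> r x\<close> with \<open>s x \<in> H\<close>, \<open>r x \<in> K\<close>. A homomorphism
  \<open>\<phi> : A \<rightarrow> D\<close> transgresses to the cocycle \<open>(x, y) \<mapsto> \<phi> (s x \<otimes> s y \<otimes> (s (x \<otimes> y))\<^sup>-\<^sup>1)\<close> on \<open>G\<close>, and
  the kernel of \<open>\<theta>'\<close> consists of the classes obtained in this way: such a class becomes trivial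
  on \<open>H \<times> K\<close>, and comparing a trivialisation on \<open>H \<times> K\<close> with the section recovers \<open>\<phi>\<close>. The
  class is trivial iff \<open>\<phi>\<close> has the form \<open>a \<mapsto> \<alpha> a \<otimes> (\<beta> a)\<^sup>-\<^sup>1\<close> with homomorphisms \<open>\<alpha>\<close> on \<open>H\<close> and
  \<open>\<beta>\<close> on \<open>K\<close>, and divisibility of \<open>D\<close> makes this equivalent to \<open>\<phi>\<close> being trivial on \<open>Z\<close>. Since
  every homomorphism on \<open>Z\<close> extends to \<open>A\<close>, the kernel is \<open>Hom(Z, D)\<close>.
\<close>

section \<open>Extending homomorphisms into divisible groups\<close>

lemma comm_group_DirProd:
  assumes "comm_group M" "comm_group D"
  shows "comm_group (M \<times>\<times> D)"
proof -
  interpret M: comm_group M by fact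
  interpret D: comm_group D by fact
  show ?thesis
    by (rule group.group_comm_groupI[OF DirProd_group])
      (auto simp: M.is_group D.is_group M.m_comm D.m_comm)
qed

lemma int_pow_DirProd:
  fixes n :: int
  assumes "group M" "group D" "x \<in> carrier M" "d \<in> carrier D"
  shows "(x, d) [^]\<^bsub>M \<times>\<times> D\<^esub> n = (x [^]\<^bsub>M\<^esub> n, d [^]\<^bsub>D\<^esub> n)"
proof -
  interpret M: group M by fact
  interpret D: group D by fact
  interpret Q: group "M \<times>\<times> D" using assms by (simp add: DirProd_group)
  have nat: "(x, d) [^]\<^bsub>M \<times>\<times> D\<^esub> k = (x [^]\<^bsub>M\<^esub> k, d [^]\<^bsub>D\<^esub> k)" for k :: nat
    by (induction k) auto
  show ?thesis
    using assms by (cases n rule: int_cases2) (simp_all add: int_pow_int M.int_pow_neg_int D.int_pow_neg_int Q.int_pow_neg_int nat)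
qed

text \<open>The quotient of two pairs over the same \<open>y\<close> lies above \<one>, where only
  the trivial value is allowed. So a subgroup meeting the second factor trivially is the graph of a
  function on its projection to \<open>M\<close>.\<close>

lemma partial_hom_single_valued:
  assumes "group M" "group D" and \<Gamma>: "subgroup \<Gamma> (M \<times>\<times> D)"
    and single: "\<And>d. (\<one>\<^bsub>M\<^esub>, d) \<in> \<Gamma> \<Longrightarrow> d = \<one>\<^bsub>D\<^esub>"
    and y: "(y, e) \<in> \<Gamma>" "(y, e') \<in> \<Gamma>"
  shows "e = e'"
proof -
  interpret M: group M by fact
  interpret D: group D by fact
  have c: "y \<in> carrier M" "e \<in> carrier D" "e' \<in> carrier D"
    using subgroup.mem_carrier[OF \<Gamma>] y by auto
  have "(y, e) \<otimes>\<^bsub>M \<times>\<times> D\<^esub> inv\<^bsub>M \<times>\<times> D\<^esub> (y, e') \<in> \<Gamma>"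
    using y subgroup.m_closed[OF \<Gamma>] subgroup.m_inv_closed[OF \<Gamma>] by blast
  then have "(\<one>\<^bsub>M\<^esub>, e \<otimes>\<^bsub>D\<^esub> inv\<^bsub>D\<^esub> e') \<in> \<Gamma>"
    using c by simp
  then show ?thesis
    using single c by (metis D.inv_closed D.inv_equality D.inv_inv)
qed

text \<open>The one-element step of Baer's argument: adjoin the cyclic subgroup generated by
  \<open>(x, d)\<close>. The result stays single-valued if \<open>d\<close> is compatible with the
  values already fixed on powers of \<open>x\<close>, and divisibility supplies such a
  \<open>d\<close>.\<close>

lemma extend_partial_hom_by_element:
  assumes "comm_group M" "comm_group D" "divisible_group D"
    and \<Gamma>: "subgroup \<Gamma> (M \<times>\<times> D)"
    and single: "\<And>d. (\<one>\<^bsub>M\<^esub>, d) \<in> \<Gamma> \<Longrightarrow> d = \<one>\<^bsub>D\<^esub>"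
    and x: "x \<in> carrier M"
  obtains \<Delta> d where "subgroup \<Delta> (M \<times>\<times> D)" "\<Gamma> \<subseteq> \<Delta>" "(x, d) \<in> \<Delta>"
    "\<forall>e. (\<one>\<^bsub>M\<^esub>, e) \<in> \<Delta> \<longrightarrow> e = \<one>\<^bsub>D\<^esub>"
proof -
  interpret M: comm_group M by fact
  interpret D: comm_group D by fact
  interpret Q: comm_group "M \<times>\<times> D" using assms by (simp add: comm_group_DirProd)
  interpret \<Gamma>: subgroup \<Gamma> "M \<times>\<times> D" by fact
  note pow = int_pow_DirProd[OF M.is_group D.is_group]
  have pow_in: "(y [^]\<^bsub>M\<^esub> k, e [^]\<^bsub>D\<^esub> k) \<in> \<Gamma>" if "(y, e) \<in> \<Gamma>" for y e and k :: int
    using \<Gamma>.mem_carrier[OF that] Q.subgroup_int_pow_closed[OF \<Gamma> that, of k] pow by auto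
  note uniq = partial_hom_single_valued[OF M.is_group D.is_group \<Gamma>, rotated, OF _ _ single]
  obtain d where d: "d \<in> carrier D"
    and d_pow: "\<And>n e. (x [^]\<^bsub>M\<^esub> (n::int), e) \<in> \<Gamma> \<Longrightarrow> e = d [^]\<^bsub>D\<^esub> n"
  proof (cases "\<exists>n::nat. n > 0 \<and> (\<exists>e. (x [^]\<^bsub>M\<^esub> n, e) \<in> \<Gamma>)")
    case True
    \<comment> \<open>The exponents of the powers of \<open>x\<close> in the domain form a subgroup
      of the integers, generated by this \<open>n\<close>; an \<open>n\<close>-th root of the value
      at that power is therefore compatible with all of them.\<close>
    define n where "n = (LEAST n::nat. n > 0 \<and> (\<exists>e. (x [^]\<^bsub>M\<^esub> n, e) \<in> \<Gamma>))"
    have "n > 0 \<and> (\<exists>e. (x [^]\<^bsub>M\<^esub> n, e) \<in> \<Gamma>)"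
      unfolding n_def using True by (rule LeastI_ex)
    then obtain e where n: "n > 0" and e: "(x [^]\<^bsub>M\<^esub> n, e) \<in> \<Gamma>" by auto
    have least: "m \<ge> n" if "m > 0" "(x [^]\<^bsub>M\<^esub> m, e) \<in> \<Gamma>" for m :: nat and e
      unfolding n_def using that by (intro Least_le) auto
    have eD: "e \<in> carrier D" using \<Gamma>.mem_carrier[OF e] by simp
    then obtain d where d: "d \<in> carrier D" "d [^]\<^bsub>D\<^esub> n = e"
      using \<open>divisible_group D\<close> n unfolding divisible_group_def by blast
    show ?thesis
    proof (rule that[OF d(1)])
      fix k :: int and e' assume k: "(x [^]\<^bsub>M\<^esub> k, e') \<in> \<Gamma>"
      \<comment> \<open>Removing the multiple of \<open>n\<close> leaves a power with exponent
        \<open>r < n\<close> in the domain, so minimality of \<open>n\<close> forces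
        \<open>r = 0\<close>.\<close>
      define q r where "q = k div int n" and "r = nat (k mod int n)"
      have r: "k = int n * q + int r" "r < n"
        using n by (auto simp: q_def r_def nat_less_iff)
      have xq: "(x [^]\<^bsub>M\<^esub> (int n * q), d [^]\<^bsub>D\<^esub> (int n * q)) \<in> \<Gamma>"
        using pow_in[OF e, of q] x d(1) unfolding d(2)[symmetric]
        by (simp add: M.int_pow_pow D.int_pow_pow flip: int_pow_int)
      have c: "e' \<in> carrier D" using \<Gamma>.mem_carrier[OF k] by simp
      have "(x [^]\<^bsub>M\<^esub> k, e') \<otimes>\<^bsub>M \<times>\<times> D\<^esub> inv\<^bsub>M \<times>\<times> D\<^esub> (x [^]\<^bsub>M\<^esub> (int n * q), d [^]\<^bsub>D\<^esub> (int n * q)) \<in> \<Gamma>"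
        using k xq by blast
      then have "(x [^]\<^bsub>M\<^esub> k \<otimes>\<^bsub>M\<^esub> inv\<^bsub>M\<^esub> (x [^]\<^bsub>M\<^esub> (int n * q)), e' \<otimes>\<^bsub>D\<^esub> inv\<^bsub>D\<^esub> (d [^]\<^bsub>D\<^esub> (int n * q))) \<in> \<Gamma>"
        using x d by simp
      moreover have "x [^]\<^bsub>M\<^esub> k \<otimes>\<^bsub>M\<^esub> inv\<^bsub>M\<^esub> (x [^]\<^bsub>M\<^esub> (int n * q)) = x [^]\<^bsub>M\<^esub> r"
        using x r(1) by (simp add: int_pow_int flip: M.int_pow_diff)
      ultimately have "(x [^]\<^bsub>M\<^esub> r, e' \<otimes>\<^bsub>D\<^esub> inv\<^bsub>D\<^esub> (d [^]\<^bsub>D\<^esub> (int n * q))) \<in> \<Gamma>" by simp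
      then have "r = 0" using least r(2) by force
      then show "e' = d [^]\<^bsub>D\<^esub> k"
        using uniq[OF k] xq r(1) by simp
    qed
  next
    case False
    show ?thesis
    \<comment> \<open>No positive power of \<open>x\<close> lies in the domain, hence no nonzero one
      (multiply the exponent by its sign). Every value would be compatible; \<one> is taken.\<close>
    proof (rule that[OF D.one_closed])
      fix k :: int and e assume k: "(x [^]\<^bsub>M\<^esub> k, e) \<in> \<Gamma>"
      have "k = 0"
      proof (rule ccontr)
        assume "k \<noteq> 0"
        have *: "(x [^]\<^bsub>M\<^esub> (k * sgn k), e [^]\<^bsub>D\<^esub> sgn k) \<in> \<Gamma>"
          using pow_in[OF k, of "sgn k"] x by (simp add: M.int_pow_pow)
        have "x [^]\<^bsub>M\<^esub> (k * sgn k) = x [^]\<^bsub>M\<^esub> nat \<bar>k\<bar>"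
          using int_pow_int[of M x "nat \<bar>k\<bar>"] by (simp add: abs_sgn[symmetric])
        then show False using False * \<open>k \<noteq> 0\<close>
          by (metis zero_less_abs_iff zero_less_nat_eq)
      qed
      then show "e = \<one>\<^bsub>D\<^esub> [^]\<^bsub>D\<^esub> k" using k single by simp
    qed
  qed
  define \<Delta> where "\<Delta> = \<Gamma> <#>\<^bsub>M \<times>\<times> D\<^esub> generate (M \<times>\<times> D) {(x, d)}"
  have gen: "generate (M \<times>\<times> D) {(x, d)} = {(x [^]\<^bsub>M\<^esub> n, d [^]\<^bsub>D\<^esub> n) | n::int. True}"
    using x d by (simp add: Q.generate_pow pow)
  have sub: "subgroup (generate (M \<times>\<times> D) {(x, d)}) (M \<times>\<times> D)"
    using x d by (intro Q.generate_is_subgroup) auto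
  show ?thesis
  proof (rule that[of \<Delta> d])
    show "subgroup \<Delta> (M \<times>\<times> D)"
      unfolding \<Delta>_def using Q.mult_norm_subgroup[OF Q.subgroup_imp_normal[OF \<Gamma>] sub] .
    show "\<Gamma> \<subseteq> \<Delta>"
    proof
      fix g assume g: "g \<in> \<Gamma>"
      have "g = g \<otimes>\<^bsub>M \<times>\<times> D\<^esub> \<one>\<^bsub>M \<times>\<times> D\<^esub>"
        using \<Gamma>.mem_carrier[OF g] by (metis Q.r_one)
      then show "g \<in> \<Delta>"
        unfolding \<Delta>_def set_mult_def using g subgroup.one_closed[OF sub] by blast
    qed
    have "(x, d) = \<one>\<^bsub>M \<times>\<times> D\<^esub> \<otimes>\<^bsub>M \<times>\<times> D\<^esub> (x, d)"
      using x d by simp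
    then show "(x, d) \<in> \<Delta>"
      unfolding \<Delta>_def set_mult_def using \<Gamma>.one_closed generate.incl[of "(x, d)"] by blast
  next
    show "\<forall>e. (\<one>\<^bsub>M\<^esub>, e) \<in> \<Delta> \<longrightarrow> e = \<one>\<^bsub>D\<^esub>"
    proof (intro allI impI)
      fix e assume "(\<one>\<^bsub>M\<^esub>, e) \<in> \<Delta>"
      then obtain y c n where y: "(y, c) \<in> \<Gamma>" and one: "\<one>\<^bsub>M\<^esub> = y \<otimes>\<^bsub>M\<^esub> x [^]\<^bsub>M\<^esub> (n::int)"
        and e: "e = c \<otimes>\<^bsub>D\<^esub> d [^]\<^bsub>D\<^esub> n"
        unfolding \<Delta>_def set_mult_def gen by auto
      have c: "y \<in> carrier M" "c \<in> carrier D" using \<Gamma>.mem_carrier[OF y] by auto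
      have "y = inv\<^bsub>M\<^esub> (x [^]\<^bsub>M\<^esub> n)"
        using one c x by (metis M.int_pow_closed M.inv_equality)
      \<comment> \<open>The \<Gamma>-part of an element over \<one> lies over a power of
        \<open>x\<close>, so \<open>d_pow\<close> determines its value, and the two factors
        cancel.\<close>
      then have "y = x [^]\<^bsub>M\<^esub> (- n)" using x by (simp add: M.int_pow_neg)
      then have "c = d [^]\<^bsub>D\<^esub> (- n)" using d_pow y by blast
      then show "e = \<one>\<^bsub>D\<^esub>" using e d by (simp add: D.int_pow_neg)
    qed
  qed
qed

text \<open>A partial homomorphism is a subgroup of the product that meets the second factor trivially;
  in this form unions of chains are immediate.\<close>
lemma partial_hom_extends:
  assumes "comm_group M" "comm_group D" "divisible_group D"
    and \<Gamma>: "subgroup \<Gamma> (M \<times>\<times> D)"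
    and single: "\<And>d. (\<one>\<^bsub>M\<^esub>, d) \<in> \<Gamma> \<Longrightarrow> d = \<one>\<^bsub>D\<^esub>"
  obtains \<Psi> where "\<Psi> \<in> hom M D" "\<And>x d. (x, d) \<in> \<Gamma> \<Longrightarrow> \<Psi> x = d"
proof -
  interpret M: comm_group M by fact
  interpret D: comm_group D by fact
  interpret Q: comm_group "M \<times>\<times> D" using assms by (simp add: comm_group_DirProd)
  define F where "F = {\<Delta>. subgroup \<Delta> (M \<times>\<times> D) \<and> \<Gamma> \<subseteq> \<Delta> \<and> (\<forall>d. (\<one>\<^bsub>M\<^esub>, d) \<in> \<Delta> \<longrightarrow> d = \<one>\<^bsub>D\<^esub>)}"
  \<comment> \<open>A maximal partial homomorphism must be defined on all of \<open>M\<close>, since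
    otherwise the one-element extension would enlarge it.\<close>
  have "\<exists>T\<in>F. \<forall>Y\<in>F. T \<subseteq> Y \<longrightarrow> Y = T"
  proof (rule subset_Zorn_nonempty)
    show "F \<noteq> {}" using \<Gamma> single by (auto simp: F_def)
  next
    fix C assume C: "C \<noteq> {}" "subset.chain F C"
    then have CA: "C \<subseteq> F" and lin: "\<And>T Y. T \<in> C \<Longrightarrow> Y \<in> C \<Longrightarrow> T \<subseteq> Y \<or> Y \<subseteq> T"
      by (auto simp: subset_chain_def)
    have sub: "subgroup T (M \<times>\<times> D)" if "T \<in> C" for T using CA that by (auto simp: F_def)
    have "subgroup (\<Union>C) (M \<times>\<times> D)"
    proof (rule Q.subgroupI)
      show "\<Union>C \<subseteq> carrier (M \<times>\<times> D)" using subgroup.subset[OF sub] by blast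
      show "\<Union>C \<noteq> {}" using C subgroup.one_closed[OF sub] by blast
    next
      fix a assume "a \<in> \<Union>C"
      then obtain T where "T \<in> C" "a \<in> T" by blast
      then show "inv\<^bsub>M \<times>\<times> D\<^esub> a \<in> \<Union>C" using subgroup.m_inv_closed[OF sub] by blast
    next
      fix a b assume "a \<in> \<Union>C" "b \<in> \<Union>C"
      then obtain T where "T \<in> C" "a \<in> T" "b \<in> T" using lin by blast
      then show "a \<otimes>\<^bsub>M \<times>\<times> D\<^esub> b \<in> \<Union>C" using subgroup.m_closed[OF sub] by blast
    qed
    then show "\<Union>C \<in> F" using C(1) CA by (fastforce simp: F_def)
  qed
  then obtain T where T: "T \<in> F" and max: "\<And>Y. Y \<in> F \<Longrightarrow> T \<subseteq> Y \<Longrightarrow> Y = T" by blast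
  have sT: "subgroup T (M \<times>\<times> D)" and \<Gamma>T: "\<Gamma> \<subseteq> T" and one: "\<And>d. (\<one>\<^bsub>M\<^esub>, d) \<in> T \<Longrightarrow> d = \<one>\<^bsub>D\<^esub>"
    using T by (auto simp: F_def)
  interpret T: subgroup T "M \<times>\<times> D" by fact
  have total: "\<exists>d. (x, d) \<in> T" if x: "x \<in> carrier M" for x
  proof -
    obtain \<Delta> d where \<Delta>: "subgroup \<Delta> (M \<times>\<times> D)" "T \<subseteq> \<Delta>" "(x, d) \<in> \<Delta>"
        "\<forall>e. (\<one>\<^bsub>M\<^esub>, e) \<in> \<Delta> \<longrightarrow> e = \<one>\<^bsub>D\<^esub>"
      using extend_partial_hom_by_element[OF assms(1-3) sT one x] by blast
    then have "\<Delta> \<in> F" using \<Gamma>T by (auto simp: F_def)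
    then show ?thesis using max \<Delta> by blast
  qed
  note uniq = partial_hom_single_valued[OF M.is_group D.is_group sT, rotated, OF _ _ one]
  define \<Psi> where "\<Psi> x = (THE d. (x, d) \<in> T)" for x
  have \<Psi>: "\<Psi> x = d" if "(x, d) \<in> T" for x d
    unfolding \<Psi>_def using that uniq by blast
  show ?thesis
  proof (rule that)
    show "\<Psi> \<in> hom M D"
    proof (rule homI)
      fix x assume "x \<in> carrier M"
      then show "\<Psi> x \<in> carrier D" using total \<Psi> T.mem_carrier by fastforce
    next
      fix x y assume "x \<in> carrier M" "y \<in> carrier M"
      then obtain d e where "(x, d) \<in> T" "(y, e) \<in> T" using total by blast
      moreover from this have "(x \<otimes>\<^bsub>M\<^esub> y, d \<otimes>\<^bsub>D\<^esub> e) \<in> T"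
        using T.m_closed by fastforce
      ultimately show "\<Psi> (x \<otimes>\<^bsub>M\<^esub> y) = \<Psi> x \<otimes>\<^bsub>D\<^esub> \<Psi> y" using \<Psi> by metis
    qed
  qed (use \<Psi> \<Gamma>T in blast)
qed

text \<open>Homomorphisms into \<open>D\<close> factor through the abelianisation of
  \<open>P\<close>, where the commutative extension result applies. The hypothesis
  \<open>triv\<close> is what lets \<psi> descend to the image of \<open>S\<close> there.\<close>

lemma hom_extends_to_divisible:
  assumes "group P" "comm_group D" "divisible_group D"
    and S: "subgroup S P" and \<psi>: "\<psi> \<in> hom (P\<lparr>carrier := S\<rparr>) D"
    and triv: "\<And>x. x \<in> S \<Longrightarrow> x \<in> derived P (carrier P) \<Longrightarrow> \<psi> x = \<one>\<^bsub>D\<^esub>"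
  obtains \<Psi> where "\<Psi> \<in> hom P D" "\<And>x. x \<in> S \<Longrightarrow> \<Psi> x = \<psi> x"
proof -
  interpret P: group P by fact
  interpret D: comm_group D by fact
  define N where "N = derived P (carrier P)"
  interpret N: normal N P unfolding N_def by (rule P.derived_self_is_normal)
  have ab: "comm_group (P Mod N)" unfolding N_def by (rule P.derived_quot_is_comm_group)
  interpret Q: group "(P Mod N) \<times>\<times> D"
    using ab by (simp add: DirProd_group comm_group.axioms(2) D.is_group)
  interpret SP: group "P\<lparr>carrier := S\<rparr>" using P.subgroup_imp_group[OF S] .
  have SinP: "x \<in> carrier P" if "x \<in> S" for x using subgroup.mem_carrier[OF S that] .
  \<comment> \<open>The image of \<gamma> is the graph of the map that \<psi> induces on the image
    of \<open>S\<close> in \<open>P Mod N\<close>.\<close>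
  define \<gamma> where "\<gamma> s = (N #>\<^bsub>P\<^esub> s, \<psi> s)" for s
  have "\<gamma> \<in> hom (P\<lparr>carrier := S\<rparr>) ((P Mod N) \<times>\<times> D)"
    using N.r_coset_hom_Mod \<psi> SinP by (auto simp: hom_def \<gamma>_def Pi_iff)
  then interpret g: group_hom "P\<lparr>carrier := S\<rparr>" "(P Mod N) \<times>\<times> D" \<gamma>
    by unfold_locales
  have "subgroup (\<gamma> ` S) ((P Mod N) \<times>\<times> D)"
    using g.img_is_subgroup by simp
  moreover have "d = \<one>\<^bsub>D\<^esub>" if "(\<one>\<^bsub>P Mod N\<^esub>, d) \<in> \<gamma> ` S" for d
  proof -
    obtain s where s: "s \<in> S" "N #>\<^bsub>P\<^esub> s = N" "d = \<psi> s"
      using \<open>(\<one>\<^bsub>P Mod N\<^esub>, d) \<in> \<gamma> ` S\<close> by (auto simp: \<gamma>_def)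
    then have "s \<in> N" using P.coset_join1 SinP N.subgroup_axioms by blast
    then show ?thesis using triv s by (simp add: N_def)
  qed
  ultimately obtain \<Psi> where \<Psi>: "\<Psi> \<in> hom (P Mod N) D"
    and eq: "\<And>x d. (x, d) \<in> \<gamma> ` S \<Longrightarrow> \<Psi> x = d"
    using partial_hom_extends[OF ab assms(2,3)] by metis
  show ?thesis
  proof (rule that[of "\<Psi> \<circ> (\<lambda>x. N #>\<^bsub>P\<^esub> x)"])
    show "\<Psi> \<circ> (\<lambda>x. N #>\<^bsub>P\<^esub> x) \<in> hom P D"
      using Group.hom_compose[OF N.r_coset_hom_Mod \<Psi>] .
    show "(\<Psi> \<circ> (\<lambda>x. N #>\<^bsub>P\<^esub> x)) x = \<psi> x" if "x \<in> S" for x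
      using eq that by (auto simp: \<gamma>_def)
  qed
qed

text \<open>Commutators die in the commutative group \<open>D\<close>, and the kernel is a subgroup.
  The derived subgroup formed inside \<open>H\<close> is the same as the one formed in
  \<open>G\<close>.\<close>

lemma hom_trivial_on_derived:
  assumes "group G" "comm_group D" "subgroup H G" "\<phi> \<in> hom (G\<lparr>carrier := H\<rparr>) D" "x \<in> derived G H"
  shows "\<phi> x = \<one>\<^bsub>D\<^esub>"
proof -
  interpret G: group G by fact
  interpret D: comm_group D by fact
  interpret HG: group "G\<lparr>carrier := H\<rparr>" using G.subgroup_imp_group assms by blast
  interpret p: group_hom "G\<lparr>carrier := H\<rparr>" D \<phi> using assms by unfold_locales
  have "derived (G\<lparr>carrier := H\<rparr>) H \<subseteq> kernel (G\<lparr>carrier := H\<rparr>) D \<phi>"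
    unfolding derived_def
  proof (rule HG.generate_subgroup_incl[OF _ p.subgroup_kernel], clarify)
    fix h k assume hk: "h \<in> H" "k \<in> H"
    let ?P = "G\<lparr>carrier := H\<rparr>"
    have c: "h \<in> carrier ?P" "k \<in> carrier ?P" using hk by auto
    then have "\<phi> (h \<otimes>\<^bsub>?P\<^esub> k \<otimes>\<^bsub>?P\<^esub> inv\<^bsub>?P\<^esub> h \<otimes>\<^bsub>?P\<^esub> inv\<^bsub>?P\<^esub> k)
        = \<phi> h \<otimes>\<^bsub>D\<^esub> \<phi> k \<otimes>\<^bsub>D\<^esub> inv\<^bsub>D\<^esub> \<phi> h \<otimes>\<^bsub>D\<^esub> inv\<^bsub>D\<^esub> \<phi> k"
      by (simp only: p.hom_mult p.hom_inv HG.m_closed HG.inv_closed)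
    also have "\<dots> = \<one>\<^bsub>D\<^esub>"
      using p.hom_closed[OF c(1)] p.hom_closed[OF c(2)]
      by (metis D.inv_closed D.m_assoc D.m_comm D.r_inv D.r_one)
    finally show "h \<otimes>\<^bsub>?P\<^esub> k \<otimes>\<^bsub>?P\<^esub> inv\<^bsub>?P\<^esub> h \<otimes>\<^bsub>?P\<^esub> inv\<^bsub>?P\<^esub> k \<in> kernel ?P D \<phi>"
      using c HG.m_closed HG.inv_closed unfolding kernel_def by blast
  qed
  then show ?thesis
    using assms G.derived_consistent[OF subset_refl assms(3)] by (auto simp: kernel_def)
qed

section \<open>Second cohomology with trivial coefficients\<close>

lemma (in group) inv_mult_cancel_left:
  assumes "x \<in> carrier G" "y \<in> carrier G"
  shows "x \<otimes> (inv x \<otimes> y) = y" "inv x \<otimes> (x \<otimes> y) = y"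
  using assms by (simp_all flip: m_assoc)

lemma (in comm_group) mult_inv_mult_cancel:
  assumes "a \<in> carrier G" "b \<in> carrier G" "c \<in> carrier G"
  shows "a \<otimes> b \<otimes> inv (a \<otimes> c) = b \<otimes> inv c"
  using assms by (simp add: inv_mult m_comm[of a b] m_assoc inv_mult_cancel_left)

locale trivial_coefficients = G: group G + D: comm_group D
  for G :: "('a, 'b) monoid_scheme" (structure) and D :: "('d, 'e) monoid_scheme"
begin

section \<open>Cocycles and coboundaries\<close>

lemma cocycle_closed:
  "\<lbrakk>f \<in> cocycles2 G D; x \<in> carrier G; y \<in> carrier G\<rbrakk> \<Longrightarrow> f (x, y) \<in> carrier D"
  by (auto simp: cocycles2_def)

lemma cocycle_eq:
  "\<lbrakk>f \<in> cocycles2 G D; x \<in> carrier G; y \<in> carrier G; z \<in> carrier G\<rbrakk>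
    \<Longrightarrow> f (y, z) \<otimes>\<^bsub>D\<^esub> f (x, y \<otimes> z) = f (x \<otimes> y, z) \<otimes>\<^bsub>D\<^esub> f (x, y)"
  by (auto simp: cocycles2_def)

text \<open>This is the cocycle identity at \<open>(\<one>, \<one>, x)\<close>. Cocycles are not
  normalised here, so the constant \<open>f (\<one>, \<one>)\<close> is carried through later
  computations.\<close>

lemma cocycle_one_left:
  assumes "f \<in> cocycles2 G D" "x \<in> carrier G"
  shows "f (\<one>, x) = f (\<one>, \<one>)"
  using cocycle_eq[OF assms(1) G.one_closed G.one_closed assms(2)] cocycle_closed[OF assms(1)] assms(2)
  by simp

lemma cocyclesI:
  assumes "\<And>x y. \<lbrakk>x \<in> carrier G; y \<in> carrier G\<rbrakk> \<Longrightarrow> f (x, y) \<in> carrier D"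
    and "\<And>x y z. \<lbrakk>x \<in> carrier G; y \<in> carrier G; z \<in> carrier G\<rbrakk>
      \<Longrightarrow> f (y, z) \<otimes>\<^bsub>D\<^esub> f (x, y \<otimes> z) = f (x \<otimes> y, z) \<otimes>\<^bsub>D\<^esub> f (x, y)"
  shows "restrict f (carrier G \<times> carrier G) \<in> cocycles2 G D"
  using assms by (auto simp: cocycles2_def)

lemma cocycle_group_comm_group: "comm_group (cocycle_group G D)"
proof (rule comm_groupI)
  fix f g assume "f \<in> carrier (cocycle_group G D)" "g \<in> carrier (cocycle_group G D)"
  then have fg: "f \<in> cocycles2 G D" "g \<in> cocycles2 G D" by (auto simp: cocycle_group_def)
  have "(\<lambda>p\<in>carrier G \<times> carrier G. f p \<otimes>\<^bsub>D\<^esub> g p) \<in> cocycles2 G D"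
  proof (rule cocyclesI)
    fix x y z assume xyz: "x \<in> carrier G" "y \<in> carrier G" "z \<in> carrier G"
    note c = fg[THEN cocycle_closed]
    have "f (y, z) \<otimes>\<^bsub>D\<^esub> g (y, z) \<otimes>\<^bsub>D\<^esub> (f (x, y \<otimes> z) \<otimes>\<^bsub>D\<^esub> g (x, y \<otimes> z))
        = (f (y, z) \<otimes>\<^bsub>D\<^esub> f (x, y \<otimes> z)) \<otimes>\<^bsub>D\<^esub> (g (y, z) \<otimes>\<^bsub>D\<^esub> g (x, y \<otimes> z))"
      using xyz c by (simp add: D.m_ac)
    also have "\<dots> = f (x \<otimes> y, z) \<otimes>\<^bsub>D\<^esub> f (x, y) \<otimes>\<^bsub>D\<^esub> (g (x \<otimes> y, z) \<otimes>\<^bsub>D\<^esub> g (x, y))"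
      using xyz fg by (simp add: cocycle_eq)
    also have "\<dots> = f (x \<otimes> y, z) \<otimes>\<^bsub>D\<^esub> g (x \<otimes> y, z) \<otimes>\<^bsub>D\<^esub> (f (x, y) \<otimes>\<^bsub>D\<^esub> g (x, y))"
      using xyz c by (simp add: D.m_ac)
    finally show "f (y, z) \<otimes>\<^bsub>D\<^esub> g (y, z) \<otimes>\<^bsub>D\<^esub> (f (x, y \<otimes> z) \<otimes>\<^bsub>D\<^esub> g (x, y \<otimes> z))
        = f (x \<otimes> y, z) \<otimes>\<^bsub>D\<^esub> g (x \<otimes> y, z) \<otimes>\<^bsub>D\<^esub> (f (x, y) \<otimes>\<^bsub>D\<^esub> g (x, y))" .
  qed (simp add: fg cocycle_closed)
  then show "f \<otimes>\<^bsub>cocycle_group G D\<^esub> g \<in> carrier (cocycle_group G D)"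
    by (simp add: cocycle_group_def)
next
  show "\<one>\<^bsub>cocycle_group G D\<^esub> \<in> carrier (cocycle_group G D)"
    by (auto simp: cocycle_group_def intro!: cocyclesI)
next
  fix f assume "f \<in> carrier (cocycle_group G D)"
  then have f: "f \<in> cocycles2 G D" by (auto simp: cocycle_group_def)
  let ?i = "\<lambda>p\<in>carrier G \<times> carrier G. inv\<^bsub>D\<^esub> f p"
  have "?i \<in> cocycles2 G D"
    by (rule cocyclesI) (simp_all add: f cocycle_closed cocycle_eq flip: D.inv_mult)
  moreover have "?i \<otimes>\<^bsub>cocycle_group G D\<^esub> f = \<one>\<^bsub>cocycle_group G D\<^esub>"
    using cocycle_closed[OF f] by (auto simp: cocycle_group_def intro!: restrict_ext)
  ultimately show "\<exists>g\<in>carrier (cocycle_group G D). g \<otimes>\<^bsub>cocycle_group G D\<^esub> f = \<one>\<^bsub>cocycle_group G D\<^esub>"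
    by (intro bexI[of _ ?i]) (simp_all add: cocycle_group_def)
next
  fix f assume "f \<in> carrier (cocycle_group G D)"
  then show "\<one>\<^bsub>cocycle_group G D\<^esub> \<otimes>\<^bsub>cocycle_group G D\<^esub> f = f"
    by (auto simp: cocycle_group_def cocycles2_def PiE_iff extensional_def fun_eq_iff)
qed (auto simp: cocycle_group_def cocycles2_def PiE_iff D.m_ac intro!: restrict_ext)

lemma coboundary_apply:
  "\<lbrakk>x \<in> carrier G; y \<in> carrier G\<rbrakk>
    \<Longrightarrow> coboundary G D \<phi> (x, y) = \<phi> y \<otimes>\<^bsub>D\<^esub> inv\<^bsub>D\<^esub> \<phi> (x \<otimes> y) \<otimes>\<^bsub>D\<^esub> \<phi> x"
  by (simp add: coboundary_def)

text \<open>The set is defined from extensional cochains, but \<open>coboundary\<close> reads only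
  values on the carrier, so any cochain may be restricted first.\<close>

lemma coboundary_in_coboundaries2:
  assumes "\<phi> \<in> carrier G \<rightarrow> carrier D"
  shows "coboundary G D \<phi> \<in> coboundaries2 G D"
proof -
  have "coboundary G D \<phi> = coboundary G D (restrict \<phi> (carrier G))"
    by (auto simp: coboundary_def intro!: restrict_ext)
  then show ?thesis using assms by (auto simp: coboundaries2_def)
qed

text \<open>Stating the trivialisation as an equation between products keeps the inverse in
  \<open>coboundary\<close> out of later verifications.\<close>

lemma coboundaries2_memI:
  assumes f: "f \<in> extensional (carrier G \<times> carrier G)"
    and \<phi>: "\<And>x. x \<in> carrier G \<Longrightarrow> \<phi> x \<in> carrier D"
    and eq: "\<And>x y. \<lbrakk>x \<in> carrier G; y \<in> carrier G\<rbrakk>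
      \<Longrightarrow> f (x, y) \<otimes>\<^bsub>D\<^esub> \<phi> (x \<otimes> y) = \<phi> x \<otimes>\<^bsub>D\<^esub> \<phi> y"
    and fD: "\<And>x y. \<lbrakk>x \<in> carrier G; y \<in> carrier G\<rbrakk> \<Longrightarrow> f (x, y) \<in> carrier D"
  shows "f \<in> coboundaries2 G D"
proof -
  have "f = coboundary G D \<phi>"
  proof (rule extensionalityI[OF f])
    show "coboundary G D \<phi> \<in> extensional (carrier G \<times> carrier G)"
      by (simp add: coboundary_def)
    fix p assume "p \<in> carrier G \<times> carrier G"
    then obtain x y where p: "p = (x, y)" and xy: "x \<in> carrier G" "y \<in> carrier G" by auto
    have "f (x, y) = \<phi> x \<otimes>\<^bsub>D\<^esub> \<phi> y \<otimes>\<^bsub>D\<^esub> inv\<^bsub>D\<^esub> \<phi> (x \<otimes> y)"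
      using xy by (simp add: D.inv_solve_right \<phi> fD eq)
    then show "f p = coboundary G D \<phi> p"
      using xy by (simp add: p coboundary_apply \<phi> D.m_ac)
  qed
  then show ?thesis using \<phi> coboundary_in_coboundaries2[of \<phi>] by auto
qed

lemma coboundaries2_memE:
  assumes "f \<in> coboundaries2 G D"
  obtains \<phi> where "f = coboundary G D \<phi>" "\<And>x. x \<in> carrier G \<Longrightarrow> \<phi> x \<in> carrier D"
  using assms by (auto simp: coboundaries2_def)

lemma coboundary_eq:
  "\<lbrakk>\<And>x. x \<in> carrier G \<Longrightarrow> \<phi> x \<in> carrier D; x \<in> carrier G; y \<in> carrier G\<rbrakk>
    \<Longrightarrow> coboundary G D \<phi> (x, y) \<otimes>\<^bsub>D\<^esub> \<phi> (x \<otimes> y) = \<phi> x \<otimes>\<^bsub>D\<^esub> \<phi> y"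
  by (simp add: coboundary_apply D.m_ac)

lemma coboundaries2_subset_cocycles2: "coboundaries2 G D \<subseteq> cocycles2 G D"
proof
  fix f assume "f \<in> coboundaries2 G D"
  then obtain \<phi> where f: "f = coboundary G D \<phi>" and \<phi>: "\<And>x. x \<in> carrier G \<Longrightarrow> \<phi> x \<in> carrier D"
    by (blast elim: coboundaries2_memE)
  show "f \<in> cocycles2 G D"
    unfolding f coboundary_def
    by (rule cocyclesI) (simp_all add: \<phi> D.m_ac G.m_assoc D.inv_mult_cancel_left)
qed

lemma coboundaries2_subgroup: "subgroup (coboundaries2 G D) (cocycle_group G D)"
proof -
  interpret C: comm_group "cocycle_group G D" by (rule cocycle_group_comm_group)
  have ext: "coboundary G D \<phi> \<in> extensional (carrier G \<times> carrier G)" for \<phi>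
    by (simp add: coboundary_def)
  show ?thesis
  proof (rule C.subgroupI)
    show "coboundaries2 G D \<subseteq> carrier (cocycle_group G D)"
      using coboundaries2_subset_cocycles2 by (simp add: cocycle_group_def)
    show "coboundaries2 G D \<noteq> {}"
      using coboundary_in_coboundaries2[of "\<lambda>_. \<one>\<^bsub>D\<^esub>"] by auto
  next
    fix f assume fB: "f \<in> coboundaries2 G D"
    then obtain \<phi> where f: "f = coboundary G D \<phi>" and \<phi>: "\<And>x. x \<in> carrier G \<Longrightarrow> \<phi> x \<in> carrier D"
      by (blast elim: coboundaries2_memE)
    define g where "g = coboundary G D (\<lambda>x. inv\<^bsub>D\<^esub> \<phi> x)"
    have g: "g \<in> coboundaries2 G D"
      unfolding g_def using \<phi> by (intro coboundary_in_coboundaries2) auto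
    have "g \<otimes>\<^bsub>cocycle_group G D\<^esub> f = \<one>\<^bsub>cocycle_group G D\<^esub>"
      by (auto simp: cocycle_group_def f g_def coboundary_apply \<phi> D.m_ac D.inv_mult_cancel_left intro!: restrict_ext)
    then have "inv\<^bsub>cocycle_group G D\<^esub> f = g"
      using fB g coboundaries2_subset_cocycles2 by (intro C.inv_equality) (auto simp: cocycle_group_def)
    then show "inv\<^bsub>cocycle_group G D\<^esub> f \<in> coboundaries2 G D" using g by simp
  next
    fix f g assume "f \<in> coboundaries2 G D" "g \<in> coboundaries2 G D"
    then obtain \<phi> \<psi> where f: "f = coboundary G D \<phi>" and \<phi>: "\<And>x. x \<in> carrier G \<Longrightarrow> \<phi> x \<in> carrier D"
      and g: "g = coboundary G D \<psi>" and \<psi>: "\<And>x. x \<in> carrier G \<Longrightarrow> \<psi> x \<in> carrier D"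
      by (metis coboundaries2_memE)
    have "f \<otimes>\<^bsub>cocycle_group G D\<^esub> g = coboundary G D (\<lambda>x. \<phi> x \<otimes>\<^bsub>D\<^esub> \<psi> x)"
      unfolding coboundary_def[of G D "\<lambda>x. \<phi> x \<otimes>\<^bsub>D\<^esub> \<psi> x"]
      by (auto simp: cocycle_group_def f g coboundary_apply \<phi> \<psi> D.m_ac D.inv_mult intro!: restrict_ext)
    then show "f \<otimes>\<^bsub>cocycle_group G D\<^esub> g \<in> coboundaries2 G D"
      using \<phi> \<psi> coboundary_in_coboundaries2[of "\<lambda>x. \<phi> x \<otimes>\<^bsub>D\<^esub> \<psi> x"] by auto
  qed
qed

end

sublocale trivial_coefficients \<subseteq> C: comm_group "cocycle_group G D"
  by (rule cocycle_group_comm_group)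

sublocale trivial_coefficients \<subseteq> B: normal "coboundaries2 G D" "cocycle_group G D"
  by (rule C.subgroup_imp_normal[OF coboundaries2_subgroup])

context trivial_coefficients
begin

section \<open>Cohomology classes; restriction and \<open>nu\<close> on representatives\<close>

definition cohomology_class :: "('a \<times> 'a \<Rightarrow> 'd) \<Rightarrow> ('a \<times> 'a \<Rightarrow> 'd) set" where
  "cohomology_class f = coboundaries2 G D #>\<^bsub>cocycle_group G D\<^esub> f"

lemma carrier_cocycle_group: "carrier (cocycle_group G D) = cocycles2 G D"
  by (simp add: cocycle_group_def)

lemma carrier_H2: "carrier (H2 G D) = cohomology_class ` cocycles2 G D"
  by (simp add: H2_def carrier_FactGroup carrier_cocycle_group cohomology_class_def[abs_def])

lemma one_H2: "\<one>\<^bsub>H2 G D\<^esub> = coboundaries2 G D"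
  by (simp add: H2_def)

lemma cohomology_class_mult:
  "\<lbrakk>f \<in> cocycles2 G D; g \<in> cocycles2 G D\<rbrakk> \<Longrightarrow>
    cohomology_class f \<otimes>\<^bsub>H2 G D\<^esub> cohomology_class g = cohomology_class (f \<otimes>\<^bsub>cocycle_group G D\<^esub> g)"
  by (simp add: H2_def cohomology_class_def B.rcos_sum carrier_cocycle_group)

lemma mem_cohomology_class_self: "f \<in> cocycles2 G D \<Longrightarrow> f \<in> cohomology_class f"
  by (simp add: cohomology_class_def C.rcos_self coboundaries2_subgroup carrier_cocycle_group)

lemma cohomology_class_eq_one_iff:
  "f \<in> cocycles2 G D \<Longrightarrow> cohomology_class f = coboundaries2 G D \<longleftrightarrow> f \<in> coboundaries2 G D"
  unfolding cohomology_class_def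
  using C.coset_join1 C.coset_join2 coboundaries2_subgroup by (metis carrier_cocycle_group)

lemma cohomology_class_eqI:
  assumes "f \<in> cocycles2 G D" "g \<in> coboundaries2 G D"
  shows "cohomology_class (g \<otimes>\<^bsub>cocycle_group G D\<^esub> f) = cohomology_class f"
proof -
  have "g \<otimes>\<^bsub>cocycle_group G D\<^esub> f \<in> coboundaries2 G D #>\<^bsub>cocycle_group G D\<^esub> f"
    using assms by (auto simp: r_coset_def)
  then show ?thesis
    unfolding cohomology_class_def using assms
    by (metis C.repr_independence coboundaries2_subgroup carrier_cocycle_group)
qed

lemma mem_cohomology_classE:
  assumes "g \<in> cohomology_class f"
  obtains b where "b \<in> coboundaries2 G D" "g = b \<otimes>\<^bsub>cocycle_group G D\<^esub> f"
  using assms by (auto simp: cohomology_class_def r_coset_def)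

lemma cocycle_mult_apply:
  "\<lbrakk>x \<in> carrier G; y \<in> carrier G\<rbrakk> \<Longrightarrow>
    (f \<otimes>\<^bsub>cocycle_group G D\<^esub> g) (x, y) = f (x, y) \<otimes>\<^bsub>D\<^esub> g (x, y)"
  by (simp add: cocycle_group_def)

lemma cocycle_restrict:
  assumes "f \<in> cocycles2 G D" "subgroup S G"
  shows "restrict f (S \<times> S) \<in> cocycles2 (G\<lparr>carrier := S\<rparr>) D"
  using assms subgroup.mem_carrier[OF assms(2)] subgroup.m_closed[OF assms(2)]
  by (auto simp: cocycles2_def PiE_iff)

lemma trivial_coefficients_subgroup:
  "subgroup S G \<Longrightarrow> trivial_coefficients (G\<lparr>carrier := S\<rparr>) D"
  using G.subgroup_imp_group by (simp add: trivial_coefficients_def D.comm_group_axioms)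

lemma coboundary_restrict:
  assumes "b \<in> coboundaries2 G D" "subgroup S G"
  shows "restrict b (S \<times> S) \<in> coboundaries2 (G\<lparr>carrier := S\<rparr>) D"
proof -
  interpret S: trivial_coefficients "G\<lparr>carrier := S\<rparr>" D
    by (rule trivial_coefficients_subgroup[OF assms(2)])
  note S = subgroup.mem_carrier[OF assms(2)] subgroup.m_closed[OF assms(2)]
  obtain \<phi> where b: "b = coboundary G D \<phi>" and \<phi>: "\<And>x. x \<in> carrier G \<Longrightarrow> \<phi> x \<in> carrier D"
    using assms(1) by (blast elim: coboundaries2_memE)
  have "restrict b (S \<times> S) = coboundary (G\<lparr>carrier := S\<rparr>) D \<phi>"
    unfolding b coboundary_def using S by (auto simp: fun_eq_iff)
  then show ?thesis using S.coboundary_in_coboundaries2[of \<phi>] \<phi> S by auto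
qed

text \<open>\<open>res2\<close> is a union over all representatives. Two of them differ by a
  coboundary, which restricts to a coboundary, so all cosets in the union coincide.\<close>

lemma res2_cohomology_class:
  assumes f: "f \<in> cocycles2 G D" and "subgroup S G"
  shows "res2 G S D (cohomology_class f) = trivial_coefficients.cohomology_class (G\<lparr>carrier := S\<rparr>) D (restrict f (S \<times> S))"
proof -
  interpret S: trivial_coefficients "G\<lparr>carrier := S\<rparr>" D
    by (rule trivial_coefficients_subgroup[OF assms(2)])
  note mem = subgroup.mem_carrier[OF assms(2)]
  have "S.cohomology_class (restrict g (S \<times> S)) = S.cohomology_class (restrict f (S \<times> S))"
    if "g \<in> cohomology_class f" for g
  proof -
    obtain b where b: "b \<in> coboundaries2 G D" "g = b \<otimes>\<^bsub>cocycle_group G D\<^esub> f"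
      using \<open>g \<in> cohomology_class f\<close> by (rule mem_cohomology_classE)
    have "restrict g (S \<times> S) = restrict b (S \<times> S) \<otimes>\<^bsub>cocycle_group (G\<lparr>carrier := S\<rparr>) D\<^esub> restrict f (S \<times> S)"
      using mem by (auto simp: b cocycle_group_def fun_eq_iff)
    then show ?thesis
      by (simp add: S.cohomology_class_eqI cocycle_restrict coboundary_restrict assms b)
  qed
  moreover have "f \<in> cohomology_class f" using f by (rule mem_cohomology_class_self)
  ultimately show ?thesis
    unfolding res2_def S.cohomology_class_def[symmetric] by blast
qed

text \<open>\<open>nu\<close> uses a representative given by choice. On commuting pairs a coboundary
  is symmetric, so the change of representative cancels.\<close>

lemma nu_cohomology_class:
  assumes f: "f \<in> cocycles2 G D" and HK: "H \<subseteq> carrier G" "K \<subseteq> carrier G"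
    and comm: "\<forall>h\<in>H. \<forall>k\<in>K. h \<otimes> k = k \<otimes> h"
  shows "nu G H K D (cohomology_class f) = (\<lambda>(h, k)\<in>H \<times> K. f (h, k) \<otimes>\<^bsub>D\<^esub> inv\<^bsub>D\<^esub> f (k, h))"
proof -
  define g where "g = (SOME g. g \<in> cohomology_class f)"
  have "g \<in> cohomology_class f"
    unfolding g_def by (rule someI[of "\<lambda>g. g \<in> cohomology_class f", OF mem_cohomology_class_self[OF f]])
  then obtain b where b: "b \<in> coboundaries2 G D" "g = b \<otimes>\<^bsub>cocycle_group G D\<^esub> f"
    by (rule mem_cohomology_classE)
  then obtain \<phi> where \<phi>: "b = coboundary G D \<phi>" "\<And>x. x \<in> carrier G \<Longrightarrow> \<phi> x \<in> carrier D"
    using coboundaries2_memE by metis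
  have "g (h, k) \<otimes>\<^bsub>D\<^esub> inv\<^bsub>D\<^esub> g (k, h) = f (h, k) \<otimes>\<^bsub>D\<^esub> inv\<^bsub>D\<^esub> f (k, h)" if "h \<in> H" "k \<in> K" for h k
  proof -
    have c: "h \<in> carrier G" "k \<in> carrier G" using that HK by auto
    have "k \<otimes> h = h \<otimes> k" using comm that by metis
    then have s: "b (k, h) = b (h, k)" and bD: "b (h, k) \<in> carrier D"
      using c \<phi>(2) by (simp_all add: \<phi>(1) coboundary_apply D.m_ac)
    show ?thesis
      using c bD cocycle_closed[OF f] 
      by (simp add: b(2) cocycle_mult_apply s D.mult_inv_mult_cancel)
  qed
  then show ?thesis
    unfolding nu_def g_def[symmetric] Let_def by (auto intro!: restrict_ext)
qed

end

section \<open>Central products\<close>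

text \<open>The factorisation is a parameter, so that all cochains below refer to one fixed choice.
  It is neither multiplicative nor normalised: \<open>s \<one>\<close> may be a nontrivial element
  of \<open>H \<inter> K\<close>.\<close>

locale central_product = trivial_coefficients G D
  for G :: "('a, 'b) monoid_scheme" (structure) and D :: "('d, 'e) monoid_scheme" +
  fixes H K :: "'a set" and s r :: "'a \<Rightarrow> 'a"
  assumes H: "subgroup H G" and K: "subgroup K G"
    and comm: "\<And>h k. \<lbrakk>h \<in> H; k \<in> K\<rbrakk> \<Longrightarrow> h \<otimes> k = k \<otimes> h"
    and s: "\<And>x. x \<in> carrier G \<Longrightarrow> s x \<in> H"
    and r: "\<And>x. x \<in> carrier G \<Longrightarrow> r x \<in> K"
    and sr: "\<And>x. x \<in> carrier G \<Longrightarrow> s x \<otimes> r x = x"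
begin

lemmas in_H = subgroup.one_closed[OF H] subgroup.m_closed[OF H] subgroup.m_inv_closed[OF H]
lemmas in_K = subgroup.one_closed[OF K] subgroup.m_closed[OF K] subgroup.m_inv_closed[OF K]
lemmas in_G = subgroup.mem_carrier[OF H] subgroup.mem_carrier[OF K]

section \<open>The central intersection and the factor set of the section\<close>

abbreviation A where "A \<equiv> H \<inter> K"
abbreviation Z where "Z \<equiv> derived G H \<inter> derived G K"

lemma A_subgroup: "subgroup A G"
  using H K by (rule G.subgroups_Inter_pair)

lemma Z_subset_A: "Z \<subseteq> A"
  using G.derived_incl[OF subset_refl H] G.derived_incl[OF subset_refl K] by blast

lemma Z_subgroup: "subgroup Z G"
  using G.derived_is_subgroup subgroup.subset[OF H] subgroup.subset[OF K]
  by (intro G.subgroups_Inter_pair) auto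

text \<open>As a member of \<open>H\<close> the element \<open>a\<close> commutes with
  \<open>K\<close>, as a member of \<open>K\<close> it commutes with \<open>H\<close>, and every
  \<open>x\<close> is a product of the two kinds.\<close>

lemma A_central:
  assumes "a \<in> A" "x \<in> carrier G"
  shows "a \<otimes> x = x \<otimes> a"
proof -
  have c: "a \<in> carrier G" "s x \<in> carrier G" "r x \<in> carrier G"
    using assms in_G s r by auto
  have 1: "a \<otimes> s x = s x \<otimes> a" using comm[OF s, of x a] assms by simp
  have 2: "a \<otimes> r x = r x \<otimes> a" using comm[OF _ r, of a x] assms by simp
  have "a \<otimes> (s x \<otimes> r x) = s x \<otimes> a \<otimes> r x" using c 1 by (simp flip: G.m_assoc)
  also have "\<dots> = s x \<otimes> r x \<otimes> a" using c 2 by (simp add: G.m_assoc)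
  finally show ?thesis using sr assms by simp
qed

text \<open>The element \<open>inv h' \<otimes> h\<close> of \<open>H\<close> equals
  \<open>k' \<otimes> inv k\<close>, so it lies in both factors; being central, it can also be
  written \<open>h \<otimes> inv h'\<close>.\<close>

lemma factors_unique_up_to_A:
  assumes "h \<in> H" "h' \<in> H" "k \<in> K" "k' \<in> K" "h \<otimes> k = h' \<otimes> k'"
  shows "h \<otimes> inv h' \<in> A" "k' = h \<otimes> inv h' \<otimes> k"
proof -
  have c: "h \<in> carrier G" "h' \<in> carrier G" "k \<in> carrier G" "k' \<in> carrier G"
    using assms in_G by auto
  obtain a where aH: "a \<in> H" and ha: "h = h' \<otimes> a"
    using c assms in_H by (intro that[of "inv h' \<otimes> h"]) (simp_all add: G.inv_mult_cancel_left)
  have aG: "a \<in> carrier G" using aH in_G by blast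
  have "h' \<otimes> (a \<otimes> k) = h' \<otimes> k'" using assms(5) c aG unfolding ha by (simp add: G.m_assoc)
  then have k': "k' = a \<otimes> k" using c aG by simp
  then have "k' \<otimes> inv k = a" using c aG by (simp add: G.m_assoc)
  then have aA: "a \<in> A" using assms in_K aH by auto
  then have "h = a \<otimes> h'" using A_central[OF aA c(2)] ha by simp
  then have "h \<otimes> inv h' = a" using c aG by (simp add: G.m_assoc)
  then show "h \<otimes> inv h' \<in> A" "k' = h \<otimes> inv h' \<otimes> k" using aA k' by auto
qed

text \<open>The factor set of the extension of \<open>G\<close> by \<open>A\<close> with middle
  group \<open>H \<times> K\<close>, where \<open>a\<close> goes to \<open>(a, inv a)\<close> and
  the section is \<open>x \<mapsto> (s x, r x)\<close>.\<close>

definition defect :: "'a \<Rightarrow> 'a \<Rightarrow> 'a" where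
  "defect x y = s x \<otimes> s y \<otimes> inv s (x \<otimes> y)"

text \<open>Commuting \<open>r x\<close> with \<open>s y\<close> makes
  \<open>(s x \<otimes> s y, r x \<otimes> r y)\<close> a factorisation of
  \<open>x \<otimes> y\<close>, to be compared with the chosen one. The defect enters the two
  components with opposite signs.\<close>

lemma
  assumes "x \<in> carrier G" "y \<in> carrier G"
  shows defect_in_A: "defect x y \<in> A"
    and s_mult: "s x \<otimes> s y = defect x y \<otimes> s (x \<otimes> y)"
    and r_mult: "r (x \<otimes> y) = defect x y \<otimes> (r x \<otimes> r y)"
proof -
  have c: "s x \<in> carrier G" "r x \<in> carrier G" "s y \<in> carrier G" "r y \<in> carrier G"
      "s (x \<otimes> y) \<in> carrier G"
    using assms in_G s r by auto
  have "r x \<otimes> (s y \<otimes> r y) = s y \<otimes> (r x \<otimes> r y)"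
    using c comm[OF s r, of y x] assms by (simp flip: G.m_assoc)
  then have "(s x \<otimes> s y) \<otimes> (r x \<otimes> r y) = s x \<otimes> (r x \<otimes> (s y \<otimes> r y))"
    using c by (simp add: G.m_assoc)
  also have "\<dots> = s x \<otimes> r x \<otimes> (s y \<otimes> r y)" using c by (simp add: G.m_assoc)
  also have "\<dots> = s (x \<otimes> y) \<otimes> r (x \<otimes> y)" using assms by (simp add: sr)
  finally have eq: "(s x \<otimes> s y) \<otimes> (r x \<otimes> r y) = s (x \<otimes> y) \<otimes> r (x \<otimes> y)" .
  show "defect x y \<in> A" "r (x \<otimes> y) = defect x y \<otimes> (r x \<otimes> r y)"
    unfolding defect_def
    by (rule factors_unique_up_to_A[OF _ _ _ _ eq]; simp add: assms s r in_H in_K)+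
  show "s x \<otimes> s y = defect x y \<otimes> s (x \<otimes> y)"
    using c by (simp add: defect_def G.m_assoc)
qed

lemma A_in_G: "a \<in> A \<Longrightarrow> a \<in> carrier G"
  using in_G by blast

text \<open>Both sides come from reducing \<open>s x \<otimes> s y \<otimes> s z\<close> by
  \<open>s_mult\<close>, once in each bracketing; centrality of the defects lets them be collected
  on the left.\<close>

lemma defect_cocycle:
  assumes "x \<in> carrier G" "y \<in> carrier G" "z \<in> carrier G"
  shows "defect y z \<otimes> defect x (y \<otimes> z) = defect (x \<otimes> y) z \<otimes> defect x y"
proof -
  note c = s[THEN in_G(1)] defect_in_A[THEN A_in_G]
  have "(defect y z \<otimes> defect x (y \<otimes> z)) \<otimes> s (x \<otimes> y \<otimes> z) = defect y z \<otimes> (defect x (y \<otimes> z) \<otimes> s (x \<otimes> (y \<otimes> z)))"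
    using assms c by (simp add: G.m_assoc)
  also have "\<dots> = defect y z \<otimes> (s x \<otimes> s (y \<otimes> z))"
    using assms by (simp flip: s_mult)
  also have "\<dots> = s x \<otimes> (defect y z \<otimes> s (y \<otimes> z))"
    using assms c A_central[OF defect_in_A, of y z "s x"] by (simp flip: G.m_assoc)
  also have "\<dots> = s x \<otimes> s y \<otimes> s z"
    using assms c by (simp add: G.m_assoc flip: s_mult)
  also have "\<dots> = defect x y \<otimes> (defect (x \<otimes> y) z \<otimes> s (x \<otimes> y \<otimes> z))"
    using assms c by (simp add: s_mult[of x y] G.m_assoc) (simp add: s_mult G.m_assoc)
  also have "\<dots> = (defect (x \<otimes> y) z \<otimes> defect x y) \<otimes> s (x \<otimes> y \<otimes> z)"
    using assms c A_central[OF defect_in_A[of x y], of "defect (x \<otimes> y) z"] by (simp flip: G.m_assoc)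
  finally show ?thesis using assms c by simp
qed

section \<open>Transgression of homomorphisms on \<open>A\<close>\<close>

abbreviation HomA where "HomA \<equiv> hom (G\<lparr>carrier := A\<rparr>) D"

lemma
  assumes "\<phi> \<in> HomA"
  shows HomA_closed: "a \<in> A \<Longrightarrow> \<phi> a \<in> carrier D"
    and HomA_mult: "\<lbrakk>a \<in> A; b \<in> A\<rbrakk> \<Longrightarrow> \<phi> (a \<otimes> b) = \<phi> a \<otimes>\<^bsub>D\<^esub> \<phi> b"
proof -
  interpret p: group_hom "G\<lparr>carrier := A\<rparr>" D \<phi>
    using assms G.subgroup_imp_group[OF A_subgroup]
    by (simp add: group_hom_def group_hom_axioms_def D.is_group)
  show "a \<in> A \<Longrightarrow> \<phi> a \<in> carrier D" "\<lbrakk>a \<in> A; b \<in> A\<rbrakk> \<Longrightarrow> \<phi> (a \<otimes> b) = \<phi> a \<otimes>\<^bsub>D\<^esub> \<phi> b"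
    using p.hom_closed[of a] p.hom_mult[of a b] by auto
qed

definition transgression :: "('a \<Rightarrow> 'd) \<Rightarrow> 'a \<times> 'a \<Rightarrow> 'd" where
  "transgression \<phi> = (\<lambda>(x, y)\<in>carrier G \<times> carrier G. \<phi> (defect x y))"

lemma transgression_apply:
  "\<lbrakk>x \<in> carrier G; y \<in> carrier G\<rbrakk> \<Longrightarrow> transgression \<phi> (x, y) = \<phi> (defect x y)"
  by (simp add: transgression_def)

lemma transgression_cocycle:
  assumes "\<phi> \<in> HomA"
  shows "transgression \<phi> \<in> cocycles2 G D"
  unfolding transgression_def
proof (rule cocyclesI)
  fix x y z assume "x \<in> carrier G" "y \<in> carrier G" "z \<in> carrier G"
  then show "(case (y, z) of (x, y) \<Rightarrow> \<phi> (defect x y)) \<otimes>\<^bsub>D\<^esub> (case (x, y \<otimes> z) of (x, y) \<Rightarrow> \<phi> (defect x y))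
      = (case (x \<otimes> y, z) of (x, y) \<Rightarrow> \<phi> (defect x y)) \<otimes>\<^bsub>D\<^esub> (case (x, y) of (x, y) \<Rightarrow> \<phi> (defect x y))"
    using HomA_mult[OF assms defect_in_A defect_in_A, symmetric] by (simp add: defect_cocycle)
qed (use HomA_closed[OF assms defect_in_A] in simp)

lemma transgression_mult:
  "transgression (\<lambda>a. \<phi> a \<otimes>\<^bsub>D\<^esub> \<psi> a) = transgression \<phi> \<otimes>\<^bsub>cocycle_group G D\<^esub> transgression \<psi>"
  by (auto simp: cocycle_group_def transgression_def intro!: restrict_ext)

lemma transgression_cong:
  "(\<And>a. a \<in> A \<Longrightarrow> \<phi> a = \<psi> a) \<Longrightarrow> transgression \<phi> = transgression \<psi>"
  using defect_in_A by (auto simp: transgression_def intro!: restrict_ext)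

lemma HomA_lambda_mult:
  assumes "\<phi> \<in> HomA" "\<psi> \<in> HomA"
  shows "(\<lambda>a. \<phi> a \<otimes>\<^bsub>D\<^esub> \<psi> a) \<in> HomA"
  using HomA_closed[OF assms(1)] HomA_closed[OF assms(2)] HomA_mult[OF assms(1)] HomA_mult[OF assms(2)]
  by (intro homI) (auto simp: D.m_ac)

lemma HomA_lambda_inv:
  assumes "\<phi> \<in> HomA"
  shows "(\<lambda>a. inv\<^bsub>D\<^esub> \<phi> a) \<in> HomA"
  using HomA_closed[OF assms] HomA_mult[OF assms]
  by (intro homI) (auto simp: D.inv_mult)

text \<open>The trivialisation \<open>t\<close> on \<open>G\<close> is corrected by \<open>\<phi>\<close> to a homomorphism \<open>\<tau>\<close> on \<open>H \<times> K\<close> that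
  extends \<open>(a, a\<^sup>-\<^sup>1) \<mapsto> \<phi> a\<close>.\<close>
lemma trivial_on_Z_if_transgression_coboundary:
  assumes \<phi>: "\<phi> \<in> HomA" and B: "transgression \<phi> \<in> coboundaries2 G D" and z: "z \<in> Z"
  shows "\<phi> z = \<one>\<^bsub>D\<^esub>"
proof -
  obtain t where t: "transgression \<phi> = coboundary G D t" and t_fun: "t \<in> carrier G \<rightarrow>\<^sub>E carrier D"
    using B by (auto simp: coboundaries2_def)
  have tD: "t x \<in> carrier D" if "x \<in> carrier G" for x using t_fun that by auto
  have t_mult: "\<phi> (defect x y) \<otimes>\<^bsub>D\<^esub> t (x \<otimes> y) = t x \<otimes>\<^bsub>D\<^esub> t y" if "x \<in> carrier G" "y \<in> carrier G" for x y
    using coboundary_eq[of t, OF tD that] that by (simp add: transgression_apply flip: t)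
  \<comment> \<open>\<open>e h k\<close> compares the given factorisation \<open>(h, k)\<close> of
    \<open>h \<otimes> k\<close> with the chosen one.\<close>
  define e where "e h k = h \<otimes> inv s (h \<otimes> k)" for h k
  have eA: "e h k \<in> A" if "h \<in> H" "k \<in> K" for h k
    unfolding e_def using that in_G
    by (intro factors_unique_up_to_A(1)[OF _ _ _ _ sr[symmetric]]) (auto intro: s r)
  have e_s: "e h k \<otimes> s (h \<otimes> k) = h" if "h \<in> H" "k \<in> K" for h k
    unfolding e_def using that in_G s[THEN in_G(1), of "h \<otimes> k"] by (simp add: G.m_assoc)
  define \<tau> where "\<tau> h k = \<phi> (e h k) \<otimes>\<^bsub>D\<^esub> t (h \<otimes> k)" for h k
  have \<tau>D: "\<tau> h k \<in> carrier D" if "h \<in> H" "k \<in> K" for h k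
    unfolding \<tau>_def using that eA HomA_closed[OF \<phi>] tD in_G by auto
  have \<tau>_mult: "\<tau> (h \<otimes> h') (k \<otimes> k') = \<tau> h k \<otimes>\<^bsub>D\<^esub> \<tau> h' k'"
    if hk: "h \<in> H" "h' \<in> H" "k \<in> K" "k' \<in> K" for h h' k k'
  proof -
    have c: "h \<in> carrier G" "h' \<in> carrier G" "k \<in> carrier G" "k' \<in> carrier G"
      using hk in_G by auto
    let ?x = "h \<otimes> k" and ?y = "h' \<otimes> k'"
    have xy: "?x \<in> carrier G" "?y \<in> carrier G" using c by auto
    note sc = s[THEN in_G(1), OF xy(1)] s[THEN in_G(1), OF xy(2)] s[THEN in_G(1), of "?x \<otimes> ?y"]
    note ec = eA[OF hk(1,3)] eA[OF hk(2,4)]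
    note dA = defect_in_A[OF xy]
    have prod: "(h \<otimes> h') \<otimes> (k \<otimes> k') = ?x \<otimes> ?y"
    proof -
      have "h' \<otimes> (k \<otimes> k') = k \<otimes> (h' \<otimes> k')"
        using c comm[OF hk(2,3)] by (simp flip: G.m_assoc)
      then show ?thesis using c by (simp add: G.m_assoc)
    qed
    \<comment> \<open>The map \<open>e\<close> turns out to be multiplicative up to the defect,
      which is what \<open>t_mult\<close> absorbs in \<tau>.\<close>
    have "e (h \<otimes> h') (k \<otimes> k') \<otimes> s (?x \<otimes> ?y) = h \<otimes> h'"
      using e_s[of "h \<otimes> h'" "k \<otimes> k'"] hk in_H in_K by (simp add: prod)
    also have "\<dots> = (e h k \<otimes> s ?x) \<otimes> (e h' k' \<otimes> s ?y)"
      using e_s hk by simp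
    also have "\<dots> = e h k \<otimes> (s ?x \<otimes> e h' k') \<otimes> s ?y"
      using sc ec[THEN A_in_G] xy by (simp add: G.m_assoc)
    also have "\<dots> = e h k \<otimes> e h' k' \<otimes> (s ?x \<otimes> s ?y)"
      using sc ec[THEN A_in_G] A_central[OF ec(2) sc(1), symmetric] xy by (simp add: G.m_assoc)
    also have "\<dots> = e h k \<otimes> e h' k' \<otimes> defect ?x ?y \<otimes> s (?x \<otimes> ?y)"
      using sc ec[THEN A_in_G] dA[THEN A_in_G] xy by (simp add: s_mult[OF xy] G.m_assoc)
    finally have "e (h \<otimes> h') (k \<otimes> k') = e h k \<otimes> e h' k' \<otimes> defect ?x ?y"
      using sc xy ec[THEN A_in_G] dA[THEN A_in_G] eA[of "h \<otimes> h'" "k \<otimes> k'"] hk in_H in_K in_G by simp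
    moreover have "e h k \<otimes> e h' k' \<in> A" using ec subgroup.m_closed[OF A_subgroup] by blast
    ultimately have "\<phi> (e (h \<otimes> h') (k \<otimes> k')) = \<phi> (e h k) \<otimes>\<^bsub>D\<^esub> \<phi> (e h' k') \<otimes>\<^bsub>D\<^esub> \<phi> (defect ?x ?y)"
      using HomA_mult[OF \<phi>] ec dA by metis
    then have "\<tau> (h \<otimes> h') (k \<otimes> k') = \<phi> (e h k) \<otimes>\<^bsub>D\<^esub> \<phi> (e h' k') \<otimes>\<^bsub>D\<^esub> (\<phi> (defect ?x ?y) \<otimes>\<^bsub>D\<^esub> t (?x \<otimes> ?y))"
      using HomA_closed[OF \<phi>] ec dA tD xy by (simp add: \<tau>_def prod D.m_assoc)
    also have "\<dots> = \<tau> h k \<otimes>\<^bsub>D\<^esub> \<tau> h' k'"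
      using HomA_closed[OF \<phi>] ec tD xy by (simp add: t_mult \<tau>_def D.m_ac)
    finally show ?thesis .
  qed
  have zA: "z \<in> A" using z Z_subset_A by blast
  then have zG: "z \<in> carrier G" by (rule A_in_G)
  \<comment> \<open>The pair \<open>(z, inv z)\<close> is the product of \<open>(z, \<one>)\<close>
    and \<open>(\<one>, inv z)\<close>. On each factor \<tau> is a homomorphism and so dies on the
    derived subgroup.\<close>
  have "\<tau> z \<one> = \<one>\<^bsub>D\<^esub>"
  proof (rule hom_trivial_on_derived[OF G.is_group D.comm_group_axioms H, of "\<lambda>h. \<tau> h \<one>"])
    show "(\<lambda>h. \<tau> h \<one>) \<in> hom (G\<lparr>carrier := H\<rparr>) D"
      using \<tau>_mult[OF _ _ in_K(1) in_K(1)] \<tau>D in_K(1) by (intro homI) auto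
  qed (use z in auto)
  moreover have "\<tau> \<one> (inv z) = \<one>\<^bsub>D\<^esub>"
  proof (rule hom_trivial_on_derived[OF G.is_group D.comm_group_axioms K, of "\<tau> \<one>"])
    show "\<tau> \<one> \<in> hom (G\<lparr>carrier := K\<rparr>) D"
      using \<tau>_mult[OF in_H(1) in_H(1)] \<tau>D in_H(1) by (intro homI) auto
    show "inv z \<in> derived G K"
      using z subgroup.m_inv_closed[OF G.derived_is_subgroup[OF subgroup.subset[OF K]]] by blast
  qed
  ultimately have 1: "\<tau> z (inv z) = \<one>\<^bsub>D\<^esub>"
    using \<tau>_mult[of z \<one> \<one> "inv z"] zA zG in_H in_K by simp
  have 2: "\<tau> \<one> \<one> = \<one>\<^bsub>D\<^esub>"
    using \<tau>_mult[of \<one> \<one> \<one> \<one>] \<tau>D[of \<one> \<one>] in_H(1) in_K(1) by (simp add: D.l_cancel_one')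
  have e1: "e \<one> \<one> \<in> A" using eA in_H(1) in_K(1) by blast
  \<comment> \<open>Both \<open>(z, inv z)\<close> and \<open>(\<one>, \<one>)\<close> multiply to
    \<one>, so their values under \<tau> differ exactly by \<open>\<phi> z\<close>. The term
    \<open>e \<one> \<one>\<close> is there because \<open>s \<one>\<close> need not be
    \<one>.\<close>
  have "e z (inv z) = z \<otimes> e \<one> \<one>" using zG s[THEN in_G(1), of \<one>] by (simp add: e_def)
  then have "\<tau> z (inv z) = \<phi> z \<otimes>\<^bsub>D\<^esub> \<tau> \<one> \<one>"
    using zG zA e1 HomA_mult[OF \<phi>] HomA_closed[OF \<phi>] tD by (simp add: \<tau>_def D.m_assoc)
  then show ?thesis using 1 2 HomA_closed[OF \<phi> zA] by simp
qed

text \<open>If \<open>\<phi> a = \<alpha> a \<otimes> (\<beta> a)\<^sup>-\<^sup>1\<close> on \<open>A\<close>, then \<open>\<alpha>\<close> vanishes on \<open>A \<inter> H'\<close>, which forces \<open>\<beta>\<close> there; so \<open>\<beta>\<close> is extended from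
  \<open>A \<inter> H'\<close> to \<open>K\<close> first, and then \<open>\<alpha>\<close> from \<open>A\<close> to \<open>H\<close>.\<close>
lemma transgression_coboundary_if_trivial_on_Z:
  assumes \<phi>: "\<phi> \<in> HomA" and D: "divisible_group D" and triv: "\<And>z. z \<in> Z \<Longrightarrow> \<phi> z = \<one>\<^bsub>D\<^esub>"
  shows "transgression \<phi> \<in> coboundaries2 G D"
proof -
  have der: "derived (G\<lparr>carrier := H\<rparr>) H = derived G H" "derived (G\<lparr>carrier := K\<rparr>) K = derived G K"
    using G.derived_consistent H K by auto
  have derH: "subgroup (derived G H) G"
    using G.derived_is_subgroup[OF subgroup.subset[OF H]] .
  \<comment> \<open>The part of \<open>A \<inter> derived G H\<close> inside
    \<open>derived G K\<close> is \<open>Z\<close>, where the prescribed value is trivial by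
    \<open>triv\<close>; hence the extension to \<open>K\<close>.\<close>
  obtain \<beta> where \<beta>: "\<beta> \<in> hom (G\<lparr>carrier := K\<rparr>) D"
    and \<beta>_eq: "\<And>x. x \<in> A \<inter> derived G H \<Longrightarrow> \<beta> x = inv\<^bsub>D\<^esub> \<phi> x"
  proof (rule hom_extends_to_divisible[OF G.subgroup_imp_group[OF K] D.comm_group_axioms D])
    show "subgroup (A \<inter> derived G H) (G\<lparr>carrier := K\<rparr>)"
      using G.subgroup_incl[OF G.subgroups_Inter_pair[OF A_subgroup derH] K] by blast
    show "(\<lambda>x. inv\<^bsub>D\<^esub> \<phi> x) \<in> hom ((G\<lparr>carrier := K\<rparr>)\<lparr>carrier := A \<inter> derived G H\<rparr>) D"
      using HomA_lambda_inv[OF \<phi>] by (auto simp: hom_def)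
  qed (use triv der in auto)
  \<comment> \<open>By the choice of \<beta> the prescribed values cancel on
    \<open>A \<inter> derived G H\<close>, so they extend to \<open>H\<close>.\<close>
  obtain \<alpha> where \<alpha>: "\<alpha> \<in> hom (G\<lparr>carrier := H\<rparr>) D"
    and \<alpha>_eq: "\<And>x. x \<in> A \<Longrightarrow> \<alpha> x = \<phi> x \<otimes>\<^bsub>D\<^esub> \<beta> x"
  proof (rule hom_extends_to_divisible[OF G.subgroup_imp_group[OF H] D.comm_group_axioms D])
    show "subgroup A (G\<lparr>carrier := H\<rparr>)"
      using G.subgroup_incl[OF A_subgroup H] by blast
    have "\<beta> \<in> HomA" using \<beta> by (auto simp: hom_def)
    then show "(\<lambda>x. \<phi> x \<otimes>\<^bsub>D\<^esub> \<beta> x) \<in> hom ((G\<lparr>carrier := H\<rparr>)\<lparr>carrier := A\<rparr>) D"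
      using HomA_lambda_mult[OF \<phi>] by simp
  qed (use HomA_closed[OF \<phi>] der \<beta>_eq in auto)
  have \<alpha>D: "\<alpha> h \<in> carrier D" if "h \<in> H" for h using \<alpha> that by (auto simp: hom_def)
  have \<beta>D: "\<beta> k \<in> carrier D" if "k \<in> K" for k using \<beta> that by (auto simp: hom_def)
  have \<alpha>_mult: "\<alpha> (x \<otimes> y) = \<alpha> x \<otimes>\<^bsub>D\<^esub> \<alpha> y" if "x \<in> H" "y \<in> H" for x y using \<alpha> that by (auto simp: hom_def)
  have \<beta>_mult: "\<beta> (x \<otimes> y) = \<beta> x \<otimes>\<^bsub>D\<^esub> \<beta> y" if "x \<in> K" "y \<in> K" for x y using \<beta> that by (auto simp: hom_def)
  show ?thesis
  \<comment> \<open>The witness is the homomorphism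
    \<open>(h, k) \<mapsto> \<alpha> h \<otimes> \<beta> k\<close> evaluated along the section. Its
    failure to be multiplicative on \<open>G\<close> is its value at \<open>(c, inv c)\<close> for
    the defect \<open>c\<close>, which is \<open>\<phi> c\<close>.\<close>
  proof (rule coboundaries2_memI[where \<phi> = "\<lambda>x. \<alpha> (s x) \<otimes>\<^bsub>D\<^esub> \<beta> (r x)"])
    fix x y assume xy: "x \<in> carrier G" "y \<in> carrier G"
    note dA = defect_in_A[OF xy]
    have dH: "defect x y \<in> H" and dK: "defect x y \<in> K" using dA by auto
    have "\<alpha> (s x) \<otimes>\<^bsub>D\<^esub> \<alpha> (s y) = \<alpha> (defect x y) \<otimes>\<^bsub>D\<^esub> \<alpha> (s (x \<otimes> y))"
      using xy dH s by (simp add: s_mult flip: \<alpha>_mult)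
    also have "\<dots> = \<phi> (defect x y) \<otimes>\<^bsub>D\<^esub> \<beta> (defect x y) \<otimes>\<^bsub>D\<^esub> \<alpha> (s (x \<otimes> y))"
      using \<alpha>_eq dA by simp
    finally have a: "\<alpha> (s x) \<otimes>\<^bsub>D\<^esub> \<alpha> (s y) = \<phi> (defect x y) \<otimes>\<^bsub>D\<^esub> \<beta> (defect x y) \<otimes>\<^bsub>D\<^esub> \<alpha> (s (x \<otimes> y))" .
    have b: "\<beta> (r (x \<otimes> y)) = \<beta> (defect x y) \<otimes>\<^bsub>D\<^esub> (\<beta> (r x) \<otimes>\<^bsub>D\<^esub> \<beta> (r y))"
      using xy dK r in_K by (simp add: r_mult \<beta>_mult)
    note c = HomA_closed[OF \<phi> dA] \<beta>D[OF dK] xy[THEN s, THEN \<alpha>D] xy[THEN r, THEN \<beta>D] \<alpha>D[OF s, of "x \<otimes> y"]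
    have "\<alpha> (s x) \<otimes>\<^bsub>D\<^esub> \<beta> (r x) \<otimes>\<^bsub>D\<^esub> (\<alpha> (s y) \<otimes>\<^bsub>D\<^esub> \<beta> (r y))
        = (\<alpha> (s x) \<otimes>\<^bsub>D\<^esub> \<alpha> (s y)) \<otimes>\<^bsub>D\<^esub> (\<beta> (r x) \<otimes>\<^bsub>D\<^esub> \<beta> (r y))"
      using c by (simp add: D.m_ac)
    also have "\<dots> = \<phi> (defect x y) \<otimes>\<^bsub>D\<^esub> (\<alpha> (s (x \<otimes> y)) \<otimes>\<^bsub>D\<^esub> (\<beta> (defect x y) \<otimes>\<^bsub>D\<^esub> (\<beta> (r x) \<otimes>\<^bsub>D\<^esub> \<beta> (r y))))"
      using c xy unfolding a by (simp add: D.m_ac)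
    finally show "transgression \<phi> (x, y) \<otimes>\<^bsub>D\<^esub> (\<alpha> (s (x \<otimes> y)) \<otimes>\<^bsub>D\<^esub> \<beta> (r (x \<otimes> y)))
        = \<alpha> (s x) \<otimes>\<^bsub>D\<^esub> \<beta> (r x) \<otimes>\<^bsub>D\<^esub> (\<alpha> (s y) \<otimes>\<^bsub>D\<^esub> \<beta> (r y))"
      using xy by (simp add: transgression_apply b)
  qed (use HomA_closed[OF \<phi>] defect_in_A \<alpha>D \<beta>D s r in \<open>auto simp: transgression_def\<close>)
qed

section \<open>The kernel of \<open>theta'\<close> consists of transgressed classes\<close>

lemma theta'_eq_one_iff:
  assumes f: "f \<in> cocycles2 G D"
  shows "theta' G H K D (cohomology_class f) = \<one>\<^bsub>theta'_target G H K D\<^esub> \<longleftrightarrow>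
    restrict f (H \<times> H) \<in> coboundaries2 (G\<lparr>carrier := H\<rparr>) D \<and>
    restrict f (K \<times> K) \<in> coboundaries2 (G\<lparr>carrier := K\<rparr>) D \<and>
    (\<forall>h\<in>H. \<forall>k\<in>K. f (h, k) = f (k, h))"
proof -
  interpret SH: trivial_coefficients "G\<lparr>carrier := H\<rparr>" D by (rule trivial_coefficients_subgroup[OF H])
  interpret SK: trivial_coefficients "G\<lparr>carrier := K\<rparr>" D by (rule trivial_coefficients_subgroup[OF K])
  have one: "\<one>\<^bsub>theta'_target G H K D\<^esub> = (coboundaries2 (G\<lparr>carrier := H\<rparr>) D,
      coboundaries2 (G\<lparr>carrier := K\<rparr>) D, \<lambda>p\<in>H \<times> K. \<one>\<^bsub>D\<^esub>)"
    by (simp add: theta'_target_def SH.one_H2 SK.one_H2 bilin_group_def)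
  have "f (h, k) \<otimes>\<^bsub>D\<^esub> inv\<^bsub>D\<^esub> f (k, h) = \<one>\<^bsub>D\<^esub> \<longleftrightarrow> f (h, k) = f (k, h)" if "h \<in> H" "k \<in> K" for h k
    using cocycle_closed[OF f] that in_G
    by (metis D.inv_closed D.inv_equality D.inv_inv D.r_inv)
  then have "(\<lambda>(h, k)\<in>H \<times> K. f (h, k) \<otimes>\<^bsub>D\<^esub> inv\<^bsub>D\<^esub> f (k, h)) = (\<lambda>p\<in>H \<times> K. \<one>\<^bsub>D\<^esub>) \<longleftrightarrow>
      (\<forall>h\<in>H. \<forall>k\<in>K. f (h, k) = f (k, h))"
    by (auto simp: fun_eq_iff restrict_def)
  moreover have "nu G H K D (cohomology_class f) = (\<lambda>(h, k)\<in>H \<times> K. f (h, k) \<otimes>\<^bsub>D\<^esub> inv\<^bsub>D\<^esub> f (k, h))"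
    using comm by (intro nu_cohomology_class[OF f subgroup.subset[OF H] subgroup.subset[OF K]]) blast
  ultimately show ?thesis
    unfolding theta'_def one using f H K
    by (simp add: res2_cohomology_class SH.cohomology_class_eq_one_iff
        SK.cohomology_class_eq_one_iff cocycle_restrict)
qed

text \<open>Solving \<open>s x \<otimes> r x = x\<close> for \<open>r x\<close> puts it into
  \<open>H\<close> as well.\<close>

lemma r_in_A: "x \<in> H \<Longrightarrow> r x \<in> A"
proof -
  assume x: "x \<in> H"
  have "x \<in> carrier G" using x in_G by blast
  note c = this s[OF this, THEN in_G(1)] r[OF this, THEN in_G(2)]
  have "r x = inv s x \<otimes> (s x \<otimes> r x)" using c by (simp add: G.inv_mult_cancel_left)
  then have "r x = inv s x \<otimes> x" using c by (simp add: sr)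
  then have "r x \<in> H" using x s c(1) in_H by simp
  then show ?thesis using r c(1) by simp
qed

lemma s_in_A: "x \<in> K \<Longrightarrow> s x \<in> A"
proof -
  assume x: "x \<in> K"
  have "x \<in> carrier G" using x in_G by blast
  note c = this s[OF this, THEN in_G(1)] r[OF this, THEN in_G(2)]
  have "s x = (s x \<otimes> r x) \<otimes> inv r x" using c by (simp add: G.m_assoc)
  then have "s x = x \<otimes> inv r x" using c by (simp add: sr)
  then have "s x \<in> K" using x r c(1) in_K by simp
  then show ?thesis using s c(1) by simp
qed

text \<open>On \<open>H\<close> the component \<open>r\<close> takes values in \<open>A\<close>, on
  \<open>K\<close> the component \<open>s\<close> does, and composing them with \<phi> trivialises
  the restrictions. The inverse used on \<open>H\<close> reflects the opposite sign of the defect in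
  \<open>r_mult\<close>.\<close>

lemma theta'_transgression:
  assumes \<phi>: "\<phi> \<in> HomA"
  shows "theta' G H K D (cohomology_class (transgression \<phi>)) = \<one>\<^bsub>theta'_target G H K D\<^esub>"
  unfolding theta'_eq_one_iff[OF transgression_cocycle[OF \<phi>]]
proof (intro conjI ballI)
  interpret SH: trivial_coefficients "G\<lparr>carrier := H\<rparr>" D by (rule trivial_coefficients_subgroup[OF H])
  interpret SK: trivial_coefficients "G\<lparr>carrier := K\<rparr>" D by (rule trivial_coefficients_subgroup[OF K])
  note closed = HomA_closed[OF \<phi>]
  have AA: "a \<otimes> b \<in> A" if "a \<in> A" "b \<in> A" for a b
    using subgroup.m_closed[OF A_subgroup that] .
  show "restrict (transgression \<phi>) (H \<times> H) \<in> coboundaries2 (G\<lparr>carrier := H\<rparr>) D"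
  proof (rule SH.coboundaries2_memI[where \<phi> = "\<lambda>x. inv\<^bsub>D\<^esub> \<phi> (r x)"])
    fix x y assume "x \<in> carrier (G\<lparr>carrier := H\<rparr>)" "y \<in> carrier (G\<lparr>carrier := H\<rparr>)"
    then have xy: "x \<in> H" "y \<in> H" by auto
    then have G: "x \<in> carrier G" "y \<in> carrier G" using in_G by auto
    note A = defect_in_A[OF G] r_in_A[OF xy(1)] r_in_A[OF xy(2)]
    have "\<phi> (r (x \<otimes> y)) = \<phi> (defect x y) \<otimes>\<^bsub>D\<^esub> (\<phi> (r x) \<otimes>\<^bsub>D\<^esub> \<phi> (r y))"
      using A AA by (simp add: r_mult[OF G] HomA_mult[OF \<phi>])
    then show "restrict (transgression \<phi>) (H \<times> H) (x, y) \<otimes>\<^bsub>D\<^esub> inv\<^bsub>D\<^esub> \<phi> (r (x \<otimes>\<^bsub>G\<lparr>carrier := H\<rparr>\<^esub> y))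
        = inv\<^bsub>D\<^esub> \<phi> (r x) \<otimes>\<^bsub>D\<^esub> inv\<^bsub>D\<^esub> \<phi> (r y)"
      using xy G A closed by (simp add: transgression_apply D.inv_mult D.inv_mult_cancel_left)
    show "restrict (transgression \<phi>) (H \<times> H) (x, y) \<in> carrier D"
      using xy G A closed by (simp add: transgression_apply)
  qed (use r_in_A closed in auto)
  show "restrict (transgression \<phi>) (K \<times> K) \<in> coboundaries2 (G\<lparr>carrier := K\<rparr>) D"
  proof (rule SK.coboundaries2_memI[where \<phi> = "\<lambda>x. \<phi> (s x)"])
    fix x y assume "x \<in> carrier (G\<lparr>carrier := K\<rparr>)" "y \<in> carrier (G\<lparr>carrier := K\<rparr>)"
    then have xy: "x \<in> K" "y \<in> K" by auto
    then have G: "x \<in> carrier G" "y \<in> carrier G" using in_G by auto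
    note A = defect_in_A[OF G] s_in_A[OF xy(1)] s_in_A[OF xy(2)] s_in_A[of "x \<otimes> y"]
    have "\<phi> (defect x y) \<otimes>\<^bsub>D\<^esub> \<phi> (s (x \<otimes> y)) = \<phi> (s x) \<otimes>\<^bsub>D\<^esub> \<phi> (s y)"
      using A xy in_K s_mult[OF G] by (simp flip: HomA_mult[OF \<phi>])
    then show "restrict (transgression \<phi>) (K \<times> K) (x, y) \<otimes>\<^bsub>D\<^esub> \<phi> (s (x \<otimes>\<^bsub>G\<lparr>carrier := K\<rparr>\<^esub> y))
        = \<phi> (s x) \<otimes>\<^bsub>D\<^esub> \<phi> (s y)"
      using xy G by (simp add: transgression_apply)
    show "restrict (transgression \<phi>) (K \<times> K) (x, y) \<in> carrier D"
      using xy G A closed by (simp add: transgression_apply)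
  qed (use s_in_A closed in auto)
  fix h k assume hk: "h \<in> H" "k \<in> K"
  then have G: "h \<in> carrier G" "k \<in> carrier G" using in_G by auto
  \<comment> \<open>For \<open>k\<close> in \<open>K\<close> the element \<open>s k\<close> is
    central, so both defects are built from the same product.\<close>
  have "defect h k = defect k h"
    unfolding defect_def using comm[OF hk] A_central[OF s_in_A[OF hk(2)], of "s h"] s[THEN in_G(1), OF G(1)]
    by simp
  then show "transgression \<phi> (h, k) = transgression \<phi> (k, h)"
    using G by (simp add: transgression_apply)
qed

text \<open>In the extension defined by \<open>f\<close> this is the associative law for the product of the
  lifts of \<open>h\<close>, \<open>k\<close>, \<open>h'\<close>, \<open>k'\<close>, where the lifts of \<open>k\<close> and \<open>h'\<close> commute.\<close>
lemma cocycle_interchange: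
  assumes f: "f \<in> cocycles2 G D" and sym: "f (h', k) = f (k, h')"
    and hk: "h \<in> H" "h' \<in> H" "k \<in> K" "k' \<in> K"
  shows "f (h \<otimes> k, h' \<otimes> k') \<otimes>\<^bsub>D\<^esub> f (h, k) \<otimes>\<^bsub>D\<^esub> f (h', k')
    = f (h \<otimes> h', k \<otimes> k') \<otimes>\<^bsub>D\<^esub> f (h, h') \<otimes>\<^bsub>D\<^esub> f (k, k')"
proof -
  have c: "h \<in> carrier G" "h' \<in> carrier G" "k \<in> carrier G" "k' \<in> carrier G"
    using hk in_G by auto
  note cl = cocycle_closed[OF f] and eq = cocycle_eq[OF f]
  have kh: "k \<otimes> h' = h' \<otimes> k" using comm[OF hk(2,3)] by simp
  have kh3: "k \<otimes> (h' \<otimes> k') = h' \<otimes> (k \<otimes> k')" using c kh by (simp flip: G.m_assoc)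
  have "f (h \<otimes> k, h' \<otimes> k') \<otimes>\<^bsub>D\<^esub> f (h, k) \<otimes>\<^bsub>D\<^esub> f (h', k')
      = f (k, h' \<otimes> k') \<otimes>\<^bsub>D\<^esub> f (h, k \<otimes> (h' \<otimes> k')) \<otimes>\<^bsub>D\<^esub> f (h', k')"
    using c eq[of h k "h' \<otimes> k'"] by simp
  also have "\<dots> = f (h, h' \<otimes> (k \<otimes> k')) \<otimes>\<^bsub>D\<^esub> (f (h', k') \<otimes>\<^bsub>D\<^esub> f (k, h' \<otimes> k'))"
    using c cl by (simp add: D.m_ac kh3)
  \<comment> \<open>Here symmetry enters: it turns \<open>f (k, h')\<close> into
    \<open>f (h', k)\<close>, which the cocycle identity at \<open>(h', k, k')\<close>
    requires.\<close>
  also have "\<dots> = f (h, h' \<otimes> (k \<otimes> k')) \<otimes>\<^bsub>D\<^esub> (f (h' \<otimes> k, k') \<otimes>\<^bsub>D\<^esub> f (h', k))"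
    using c eq[of k h' k'] by (simp add: kh sym)
  also have "\<dots> = f (k, k') \<otimes>\<^bsub>D\<^esub> (f (h', k \<otimes> k') \<otimes>\<^bsub>D\<^esub> f (h, h' \<otimes> (k \<otimes> k')))"
    using c cl eq[of h' k k', symmetric] by (simp add: D.m_ac)
  also have "\<dots> = f (k, k') \<otimes>\<^bsub>D\<^esub> (f (h \<otimes> h', k \<otimes> k') \<otimes>\<^bsub>D\<^esub> f (h, h'))"
    using c eq[of h h' "k \<otimes> k'"] by simp
  also have "\<dots> = f (h \<otimes> h', k \<otimes> k') \<otimes>\<^bsub>D\<^esub> f (h, h') \<otimes>\<^bsub>D\<^esub> f (k, k')"
    using c cl by (simp add: D.m_ac)
  finally show ?thesis .
qed

text \<open>The kernel condition makes the pullback of \<open>f\<close> to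
  \<open>H \<times> K\<close> a coboundary, trivialised by \<tau>. On the pairs
  \<open>(a, inv a)\<close> over \<one>, \<tau> yields \<phi>; along the section it yields the
  cochain whose coboundary separates \<open>f\<close> from the transgression of \<phi>.\<close>

lemma kernel_theta'_is_transgression:
  assumes f: "f \<in> cocycles2 G D"
    and ker: "theta' G H K D (cohomology_class f) = \<one>\<^bsub>theta'_target G H K D\<^esub>"
  shows "\<exists>\<phi>\<in>HomA. cohomology_class f = cohomology_class (transgression \<phi>)"
proof -
  interpret SH: trivial_coefficients "G\<lparr>carrier := H\<rparr>" D by (rule trivial_coefficients_subgroup[OF H])
  interpret SK: trivial_coefficients "G\<lparr>carrier := K\<rparr>" D by (rule trivial_coefficients_subgroup[OF K])
  note cl = cocycle_closed[OF f]
  have sym: "f (h, k) = f (k, h)" if "h \<in> H" "k \<in> K" for h k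
    using ker that theta'_eq_one_iff[OF f] by blast
  obtain u where u_fun: "u \<in> H \<rightarrow>\<^sub>E carrier D"
    and u: "restrict f (H \<times> H) = coboundary (G\<lparr>carrier := H\<rparr>) D u"
    using ker unfolding theta'_eq_one_iff[OF f] by (auto simp: coboundaries2_def)
  obtain v where v_fun: "v \<in> K \<rightarrow>\<^sub>E carrier D"
    and v: "restrict f (K \<times> K) = coboundary (G\<lparr>carrier := K\<rparr>) D v"
    using ker unfolding theta'_eq_one_iff[OF f] by (auto simp: coboundaries2_def)
  have uD: "u h \<in> carrier D" if "h \<in> H" for h using u_fun that by auto
  have vD: "v k \<in> carrier D" if "k \<in> K" for k using v_fun that by auto
  have u_mult: "f (h, h') \<otimes>\<^bsub>D\<^esub> u (h \<otimes> h') = u h \<otimes>\<^bsub>D\<^esub> u h'" if "h \<in> H" "h' \<in> H" for h h'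
    using SH.coboundary_eq[of u h h'] uD that by (simp flip: u)
  have v_mult: "f (k, k') \<otimes>\<^bsub>D\<^esub> v (k \<otimes> k') = v k \<otimes>\<^bsub>D\<^esub> v k'" if "k \<in> K" "k' \<in> K" for k k'
    using SK.coboundary_eq[of v k k'] vD that by (simp flip: v)
  \<comment> \<open>In the extension defined by \<open>f\<close>, the lift of
    \<open>h \<otimes> k\<close> and the product of the lifts of \<open>h\<close> and
    \<open>k\<close> differ by \<open>f (h, k)\<close>; the last factor corrects for this.\<close>
  define \<tau> where "\<tau> h k = u h \<otimes>\<^bsub>D\<^esub> v k \<otimes>\<^bsub>D\<^esub> inv\<^bsub>D\<^esub> f (h, k)" for h k
  have \<tau>D: "\<tau> h k \<in> carrier D" if "h \<in> H" "k \<in> K" for h k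
    using uD vD cl that in_G by (simp add: \<tau>_def)
  have \<tau>_f: "\<tau> h k \<otimes>\<^bsub>D\<^esub> f (h, k) = u h \<otimes>\<^bsub>D\<^esub> v k" if "h \<in> H" "k \<in> K" for h k
    using uD vD cl that in_G by (simp add: \<tau>_def D.m_assoc)
  have \<tau>_mult: "f (h \<otimes> k, h' \<otimes> k') \<otimes>\<^bsub>D\<^esub> \<tau> (h \<otimes> h') (k \<otimes> k') = \<tau> h k \<otimes>\<^bsub>D\<^esub> \<tau> h' k'"
    if hk: "h \<in> H" "h' \<in> H" "k \<in> K" "k' \<in> K" for h h' k k'
  proof -
    have c: "h \<in> carrier G" "h' \<in> carrier G" "k \<in> carrier G" "k' \<in> carrier G"
      using hk in_G by auto
    have hh: "h \<otimes> h' \<in> H" "k \<otimes> k' \<in> K" using hk in_H in_K by auto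
    let ?X = "f (h \<otimes> k, h' \<otimes> k')" and ?a = "f (h, k)" and ?b = "f (h', k')"
      and ?c = "f (h \<otimes> h', k \<otimes> k')" and ?d = "f (h, h')" and ?e = "f (k, k')"
      and ?T = "\<tau> (h \<otimes> h') (k \<otimes> k')" and ?U = "u (h \<otimes> h')" and ?V = "v (k \<otimes> k')"
    have D: "?X \<in> carrier D" "?a \<in> carrier D" "?b \<in> carrier D" "?c \<in> carrier D" "?d \<in> carrier D"
        "?e \<in> carrier D" "?T \<in> carrier D" "?U \<in> carrier D" "?V \<in> carrier D" "u h \<in> carrier D"
        "u h' \<in> carrier D" "v k \<in> carrier D" "v k' \<in> carrier D" "\<tau> h k \<in> carrier D" "\<tau> h' k' \<in> carrier D"
      using c hk hh cl uD vD \<tau>D by auto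
    \<comment> \<open>Multiplying by \<open>?a\<close>, \<open>?b\<close> and \<open>?c\<close>
      clears the inverses hidden in the three values of \<tau> and produces the left side of the
      interchange law.\<close>
    have "?X \<otimes>\<^bsub>D\<^esub> ?T \<otimes>\<^bsub>D\<^esub> (?a \<otimes>\<^bsub>D\<^esub> ?b \<otimes>\<^bsub>D\<^esub> ?c) = (?X \<otimes>\<^bsub>D\<^esub> ?a \<otimes>\<^bsub>D\<^esub> ?b) \<otimes>\<^bsub>D\<^esub> (?T \<otimes>\<^bsub>D\<^esub> ?c)"
      using D by (simp add: D.m_ac)
    also have "\<dots> = (?c \<otimes>\<^bsub>D\<^esub> ?d \<otimes>\<^bsub>D\<^esub> ?e) \<otimes>\<^bsub>D\<^esub> (?U \<otimes>\<^bsub>D\<^esub> ?V)"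
      using cocycle_interchange[OF f sym[OF hk(2,3)] hk] \<tau>_f[OF hh] by simp
    also have "\<dots> = ?c \<otimes>\<^bsub>D\<^esub> ((?d \<otimes>\<^bsub>D\<^esub> ?U) \<otimes>\<^bsub>D\<^esub> (?e \<otimes>\<^bsub>D\<^esub> ?V))"
      using D by (simp add: D.m_ac)
    also have "\<dots> = ?c \<otimes>\<^bsub>D\<^esub> ((u h \<otimes>\<^bsub>D\<^esub> u h') \<otimes>\<^bsub>D\<^esub> (v k \<otimes>\<^bsub>D\<^esub> v k'))"
      using hk by (simp add: u_mult v_mult)
    also have "\<dots> = ?c \<otimes>\<^bsub>D\<^esub> ((u h \<otimes>\<^bsub>D\<^esub> v k) \<otimes>\<^bsub>D\<^esub> (u h' \<otimes>\<^bsub>D\<^esub> v k'))"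
      using D by (simp add: D.m_ac)
    also have "\<dots> = ?c \<otimes>\<^bsub>D\<^esub> ((\<tau> h k \<otimes>\<^bsub>D\<^esub> ?a) \<otimes>\<^bsub>D\<^esub> (\<tau> h' k' \<otimes>\<^bsub>D\<^esub> ?b))"
      using hk by (simp add: \<tau>_f)
    also have "\<dots> = \<tau> h k \<otimes>\<^bsub>D\<^esub> \<tau> h' k' \<otimes>\<^bsub>D\<^esub> (?a \<otimes>\<^bsub>D\<^esub> ?b \<otimes>\<^bsub>D\<^esub> ?c)"
      using D by (simp add: D.m_ac)
    finally show ?thesis using D by simp
  qed
  let ?F = "f (\<one>, \<one>)"
  have FD: "?F \<in> carrier D" using cl by simp
  \<comment> \<open>On pairs over \<one> the cocycle in \<open>\<tau>_mult\<close> is the constant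
    \<open>?F\<close>, so \<tau> is multiplicative there up to \<open>?F\<close>. Dividing
    \<open>?F\<close> by \<tau> removes the constant and gives a true homomorphism.\<close>
  define \<phi> where "\<phi> a = ?F \<otimes>\<^bsub>D\<^esub> inv\<^bsub>D\<^esub> \<tau> a (inv a)" for a
  have \<tau>A: "\<tau> a (inv a) \<in> carrier D" if "a \<in> A" for a using that \<tau>D in_K by auto
  have \<phi>D: "\<phi> a \<in> carrier D" if "a \<in> A" for a using that FD \<tau>A by (simp add: \<phi>_def)
  have \<phi>_\<tau>: "\<phi> a \<otimes>\<^bsub>D\<^esub> \<tau> a (inv a) = ?F" if "a \<in> A" for a
    using that FD \<tau>A by (simp add: \<phi>_def D.m_assoc)
  have \<tau>_A: "?F \<otimes>\<^bsub>D\<^esub> \<tau> (a \<otimes> h) (inv a \<otimes> k) = \<tau> a (inv a) \<otimes>\<^bsub>D\<^esub> \<tau> h k"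
    if "a \<in> A" "h \<in> H" "k \<in> K" for a h k
  proof -
    have "a \<in> carrier G" using that(1) by (rule A_in_G)
    moreover have "f (\<one>, h \<otimes> k) = ?F" using that in_G by (intro cocycle_one_left[OF f]) auto
    ultimately show ?thesis using that \<tau>_mult[of a h "inv a" k] in_K by simp
  qed
  have "\<phi> \<in> HomA"
  proof (rule homI)
    fix a b assume "a \<in> carrier (G\<lparr>carrier := A\<rparr>)" "b \<in> carrier (G\<lparr>carrier := A\<rparr>)"
    then have ab: "a \<in> A" "b \<in> A" by auto
    then have abA: "a \<otimes> b \<in> A" using subgroup.m_closed[OF A_subgroup] by blast
    have G: "a \<in> carrier G" "b \<in> carrier G" using ab A_in_G by auto
    have inv: "inv (a \<otimes> b) = inv a \<otimes> inv b"
      using A_central[OF ab(1) G(2)] G by (simp add: G.inv_mult_group)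
    note D = FD \<phi>D[OF ab(1)] \<phi>D[OF ab(2)] \<phi>D[OF abA] \<tau>A[OF ab(1)] \<tau>A[OF ab(2)] \<tau>A[OF abA]
    have "\<phi> (a \<otimes> b) \<otimes>\<^bsub>D\<^esub> (\<tau> (a \<otimes> b) (inv (a \<otimes> b)) \<otimes>\<^bsub>D\<^esub> ?F) = ?F \<otimes>\<^bsub>D\<^esub> ?F"
      using \<phi>_\<tau>[OF abA] D by (simp flip: D.m_assoc)
    also have "\<dots> = (\<phi> a \<otimes>\<^bsub>D\<^esub> \<tau> a (inv a)) \<otimes>\<^bsub>D\<^esub> (\<phi> b \<otimes>\<^bsub>D\<^esub> \<tau> b (inv b))"
      using ab by (simp add: \<phi>_\<tau>)
    also have "\<dots> = \<phi> a \<otimes>\<^bsub>D\<^esub> \<phi> b \<otimes>\<^bsub>D\<^esub> (\<tau> a (inv a) \<otimes>\<^bsub>D\<^esub> \<tau> b (inv b))"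
      using D by (simp add: D.m_ac)
    also have "\<dots> = \<phi> a \<otimes>\<^bsub>D\<^esub> \<phi> b \<otimes>\<^bsub>D\<^esub> (\<tau> (a \<otimes> b) (inv (a \<otimes> b)) \<otimes>\<^bsub>D\<^esub> ?F)"
      using ab in_K D \<tau>_A[of a b "inv b"] by (simp add: inv D.m_comm)
    finally show "\<phi> (a \<otimes>\<^bsub>G\<lparr>carrier := A\<rparr>\<^esub> b) = \<phi> a \<otimes>\<^bsub>D\<^esub> \<phi> b"
      using D by simp
  qed (use \<phi>D in simp)
  moreover
  define g where "g x = \<tau> (s x) (r x)" for x
  have gD: "g x \<in> carrier D" if "x \<in> carrier G" for x using that \<tau>D s r by (simp add: g_def)
  have "f = coboundary G D g \<otimes>\<^bsub>cocycle_group G D\<^esub> transgression \<phi>"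
  proof (rule extensionalityI)
    show "f \<in> extensional (carrier G \<times> carrier G)" using f by (auto simp: cocycles2_def PiE_def)
    show "coboundary G D g \<otimes>\<^bsub>cocycle_group G D\<^esub> transgression \<phi> \<in> extensional (carrier G \<times> carrier G)"
      by (simp add: cocycle_group_def)
    fix p assume "p \<in> carrier G \<times> carrier G"
    then obtain x y where p: "p = (x, y)" and xy: "x \<in> carrier G" "y \<in> carrier G" by auto
    then have xyG: "x \<otimes> y \<in> carrier G" by simp
    let ?c = "defect x y" and ?T = "\<tau> (s x \<otimes> s y) (r x \<otimes> r y)" and ?b = "coboundary G D g (x, y)"
    note cA = defect_in_A[OF xy]
    have cG: "?c \<in> carrier G" using cA by (rule A_in_G)
    have rG: "r x \<otimes> r y \<in> carrier G" using xy r in_G by simp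
    have T: "?T \<in> carrier D" using xy s r in_H in_K by (intro \<tau>D) auto
    have b: "?b \<in> carrier D" using xy gD by (simp add: coboundary_apply)
    note D = T b FD \<tau>A[OF cA] \<phi>D[OF cA] gD[OF xyG] gD[OF xy(1)] gD[OF xy(2)] cl[OF xy]
    have 1: "f (x, y) \<otimes>\<^bsub>D\<^esub> ?T = g x \<otimes>\<^bsub>D\<^esub> g y"
      using \<tau>_mult[of "s x" "s y" "r x" "r y"] xy s r by (simp add: sr g_def)
    \<comment> \<open>The pair \<open>(s x \<otimes> s y, r x \<otimes> r y)\<close> is the chosen
      pair over \<open>x \<otimes> y\<close> times \<open>(?c, inv ?c)\<close>.\<close>
    have 2: "?F \<otimes>\<^bsub>D\<^esub> ?T = \<tau> ?c (inv ?c) \<otimes>\<^bsub>D\<^esub> g (x \<otimes> y)"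
      using \<tau>_A[OF cA s[OF xyG] r[OF xyG]] cG rG
      by (simp add: g_def s_mult[OF xy] r_mult[OF xy] G.inv_mult_cancel_left)
    have 3: "?b \<otimes>\<^bsub>D\<^esub> g (x \<otimes> y) = g x \<otimes>\<^bsub>D\<^esub> g y"
      using xy gD by (intro coboundary_eq) auto
    have "f (x, y) \<otimes>\<^bsub>D\<^esub> (?T \<otimes>\<^bsub>D\<^esub> (\<tau> ?c (inv ?c) \<otimes>\<^bsub>D\<^esub> g (x \<otimes> y)))
        = (f (x, y) \<otimes>\<^bsub>D\<^esub> ?T) \<otimes>\<^bsub>D\<^esub> (\<tau> ?c (inv ?c) \<otimes>\<^bsub>D\<^esub> g (x \<otimes> y))"
      using D by (simp add: D.m_assoc)
    also have "\<dots> = (?b \<otimes>\<^bsub>D\<^esub> g (x \<otimes> y)) \<otimes>\<^bsub>D\<^esub> (?F \<otimes>\<^bsub>D\<^esub> ?T)"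
      by (simp add: 1 2 3)
    also have "\<dots> = (?b \<otimes>\<^bsub>D\<^esub> g (x \<otimes> y)) \<otimes>\<^bsub>D\<^esub> ((\<phi> ?c \<otimes>\<^bsub>D\<^esub> \<tau> ?c (inv ?c)) \<otimes>\<^bsub>D\<^esub> ?T)"
      by (simp add: \<phi>_\<tau>[OF cA])
    also have "\<dots> = (?b \<otimes>\<^bsub>D\<^esub> \<phi> ?c) \<otimes>\<^bsub>D\<^esub> (?T \<otimes>\<^bsub>D\<^esub> (\<tau> ?c (inv ?c) \<otimes>\<^bsub>D\<^esub> g (x \<otimes> y)))"
      using D by (simp add: D.m_ac)
    finally have "f (x, y) = ?b \<otimes>\<^bsub>D\<^esub> \<phi> ?c" using D by simp
    then show "f p = (coboundary G D g \<otimes>\<^bsub>cocycle_group G D\<^esub> transgression \<phi>) p"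
      using xy by (simp add: p cocycle_mult_apply transgression_apply)
  qed
  moreover have "coboundary G D g \<in> coboundaries2 G D"
    using gD by (intro coboundary_in_coboundaries2) auto
  ultimately show ?thesis
    using cohomology_class_eqI transgression_cocycle by metis
qed

section \<open>Comparison of transgressed classes and passage to Hom(Z, D)\<close>

lemma transgression_class_eq_iff:
  assumes \<phi>: "\<phi> \<in> HomA" and \<psi>: "\<psi> \<in> HomA" and D: "divisible_group D"
  shows "cohomology_class (transgression \<phi>) = cohomology_class (transgression \<psi>) \<longleftrightarrow> (\<forall>z\<in>Z. \<phi> z = \<psi> z)"
proof -
  \<comment> \<open>Transgression is multiplicative in the homomorphism, so the question reduces to
    when the quotient \<delta> transgresses to a coboundary.\<close>
  define \<delta> where "\<delta> a = \<phi> a \<otimes>\<^bsub>D\<^esub> inv\<^bsub>D\<^esub> \<psi> a" for a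
  have \<delta>: "\<delta> \<in> HomA"
    unfolding \<delta>_def[abs_def] by (intro HomA_lambda_mult HomA_lambda_inv \<phi> \<psi>)
  have \<delta>_\<psi>: "\<delta> a \<otimes>\<^bsub>D\<^esub> \<psi> a = \<phi> a" if "a \<in> A" for a
    using HomA_closed[OF \<phi> that] HomA_closed[OF \<psi> that] by (simp add: \<delta>_def D.m_assoc)
  have tr: "transgression \<phi> = transgression \<delta> \<otimes>\<^bsub>cocycle_group G D\<^esub> transgression \<psi>"
    unfolding transgression_mult[symmetric] by (intro transgression_cong) (simp add: \<delta>_\<psi>)
  note c = transgression_cocycle[OF \<phi>] transgression_cocycle[OF \<psi>] transgression_cocycle[OF \<delta>]
  have "cohomology_class (transgression \<phi>) = cohomology_class (transgression \<psi>)
      \<longleftrightarrow> transgression \<delta> \<in> coboundaries2 G D"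
  proof
    assume "cohomology_class (transgression \<phi>) = cohomology_class (transgression \<psi>)"
    then obtain b where b: "b \<in> coboundaries2 G D"
        "transgression \<phi> = b \<otimes>\<^bsub>cocycle_group G D\<^esub> transgression \<psi>"
      using mem_cohomology_class_self[OF c(1)] mem_cohomology_classE by metis
    then have "b = transgression \<delta>"
      using tr c coboundaries2_subset_cocycles2 C.r_cancel[of b "transgression \<psi>" "transgression \<delta>"]
      by (auto simp: carrier_cocycle_group)
    then show "transgression \<delta> \<in> coboundaries2 G D" using b by simp
  next
    assume "transgression \<delta> \<in> coboundaries2 G D"
    then show "cohomology_class (transgression \<phi>) = cohomology_class (transgression \<psi>)"
      unfolding tr using c by (simp add: cohomology_class_eqI)
  qed
  also have "\<dots> \<longleftrightarrow> (\<forall>z\<in>Z. \<delta> z = \<one>\<^bsub>D\<^esub>)"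
    using trivial_on_Z_if_transgression_coboundary[OF \<delta>]
      transgression_coboundary_if_trivial_on_Z[OF \<delta> D] by blast
  also have "\<dots> \<longleftrightarrow> (\<forall>z\<in>Z. \<phi> z = \<psi> z)"
  proof (rule ball_cong[OF refl])
    fix z assume "z \<in> Z"
    then have "z \<in> A" using Z_subset_A by blast
    then show "\<delta> z = \<one>\<^bsub>D\<^esub> \<longleftrightarrow> \<phi> z = \<psi> z"
      using \<delta>_\<psi> HomA_closed[OF \<phi>] HomA_closed[OF \<psi>] by (metis D.l_one D.r_inv \<delta>_def)
  qed
  finally show ?thesis .
qed

text \<open>Since \<open>A\<close> is commutative, its derived subgroup is trivial and the extension
  criterion only concerns \<one>.\<close>

lemma hom_extends_from_Z_to_A:
  assumes D: "divisible_group D" and \<phi>: "\<phi> \<in> hom (G\<lparr>carrier := Z\<rparr>) D"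
  shows "\<exists>\<Phi>\<in>HomA. \<forall>z\<in>Z. \<Phi> z = \<phi> z"
proof -
  interpret AG: comm_group "G\<lparr>carrier := A\<rparr>"
    using G.subgroup_imp_group[OF A_subgroup] A_central A_in_G by (intro group.group_comm_groupI) auto
  have "subgroup Z (G\<lparr>carrier := A\<rparr>)"
    using G.subgroup_incl[OF Z_subgroup A_subgroup Z_subset_A] .
  moreover have "\<phi> \<in> hom ((G\<lparr>carrier := A\<rparr>)\<lparr>carrier := Z\<rparr>) D" using \<phi> by simp
  moreover have "\<phi> z = \<one>\<^bsub>D\<^esub>" if "z \<in> derived (G\<lparr>carrier := A\<rparr>) (carrier (G\<lparr>carrier := A\<rparr>))" for z
  proof -
    interpret p: group_hom "G\<lparr>carrier := Z\<rparr>" D \<phi>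
      using \<phi> G.subgroup_imp_group[OF Z_subgroup] by (simp add: group_hom_def group_hom_axioms_def D.is_group)
    show ?thesis using that p.hom_one AG.derived_eq_singleton[OF subset_refl] by simp
  qed
  ultimately obtain \<Phi> where "\<Phi> \<in> HomA" "\<And>z. z \<in> Z \<Longrightarrow> \<Phi> z = \<phi> z"
    using hom_extends_to_divisible[OF AG.is_group D.comm_group_axioms D] by metis
  then show ?thesis by blast
qed

end

section \<open>Construction of \<chi> and exactness of the sequence\<close>

theorem theorem3p3:
  fixes G :: "('a, 'b) monoid_scheme" and D :: "('d, 'e) monoid_scheme"
    and H K :: "'a set"
  assumes "group G"
    and "H \<lhd> G" and "K \<lhd> G"
    and "H <#>\<^bsub>G\<^esub> K = carrier G"
    and "\<forall>h \<in> H. \<forall>k \<in> K. h \<otimes>\<^bsub>G\<^esub> k = k \<otimes>\<^bsub>G\<^esub> h"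
    and "comm_group D" and "divisible_group D"
  shows "\<exists>\<chi>. \<chi> \<in> hom (hom_group G (derived G H \<inter> derived G K) D) (H2 G D)
           \<and> inj_on \<chi> (carrier (hom_group G (derived G H \<inter> derived G K) D))
           \<and> \<chi> ` carrier (hom_group G (derived G H \<inter> derived G K) D)
               = kernel (H2 G D) (theta'_target G H K D) (theta' G H K D)
           \<and> hom_group G (derived G H \<inter> derived G K) D
               \<cong> (H2 G D)\<lparr>carrier := kernel (H2 G D) (theta'_target G H K D) (theta' G H K D)\<rparr>"
proof -
  interpret G: group G by fact
  interpret D: comm_group D by fact
  have "\<forall>x\<in>carrier G. \<exists>h k. h \<in> H \<and> k \<in> K \<and> h \<otimes>\<^bsub>G\<^esub> k = x"
    unfolding assms(4)[symmetric] by (auto simp: set_mult_def)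
  then obtain s r where sr: "\<forall>x\<in>carrier G. s x \<in> H \<and> r x \<in> K \<and> s x \<otimes>\<^bsub>G\<^esub> r x = x"
    by metis
  interpret central_product G D H K s r
    using assms(5) sr normal_imp_subgroup[OF assms(2)] normal_imp_subgroup[OF assms(3)]
    by (intro central_product.intro trivial_coefficients.intro central_product_axioms.intro
        G.is_group D.comm_group_axioms) auto
  define \<H> where "\<H> = hom_group G Z D"
  have carrier_\<H>: "carrier \<H> = hom (G\<lparr>carrier := Z\<rparr>) D \<inter> extensional Z"
    and mult_\<H>: "\<phi> \<otimes>\<^bsub>\<H>\<^esub> \<psi> = (\<lambda>z\<in>Z. \<phi> z \<otimes>\<^bsub>D\<^esub> \<psi> z)" for \<phi> \<psi>
    by (simp_all add: \<H>_def hom_group_def)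
  have "\<forall>\<phi>\<in>carrier \<H>. \<exists>\<Phi>. \<Phi> \<in> HomA \<and> (\<forall>z\<in>Z. \<Phi> z = \<phi> z)"
    using hom_extends_from_Z_to_A[OF assms(7)] unfolding carrier_\<H> by blast
  then obtain E where E: "\<And>\<phi>. \<phi> \<in> carrier \<H> \<Longrightarrow> E \<phi> \<in> HomA"
    and E_Z: "\<And>\<phi> z. \<lbrakk>\<phi> \<in> carrier \<H>; z \<in> Z\<rbrakk> \<Longrightarrow> E \<phi> z = \<phi> z"
    by metis
  define \<chi> where "\<chi> \<phi> = cohomology_class (transgression (E \<phi>))" for \<phi>
  \<comment> \<open>The class depends only on the values on \<open>Z\<close>, so any extension to
    \<open>A\<close> may replace the arbitrarily chosen \<open>E \<phi>\<close>.\<close>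
  have \<chi>_eqI: "\<chi> \<phi> = cohomology_class (transgression \<Phi>)"
    if "\<phi> \<in> carrier \<H>" "\<Phi> \<in> HomA" "\<And>z. z \<in> Z \<Longrightarrow> \<Phi> z = \<phi> z" for \<phi> \<Phi>
    unfolding \<chi>_def using transgression_class_eq_iff[OF E[OF that(1)] that(2) assms(7)] that E_Z by simp
  define \<N> where "\<N> = kernel (H2 G D) (theta'_target G H K D) (theta' G H K D)"
  have mult_closed: "\<phi> \<otimes>\<^bsub>\<H>\<^esub> \<psi> \<in> carrier \<H>" if "\<phi> \<in> carrier \<H>" "\<psi> \<in> carrier \<H>" for \<phi> \<psi>
  proof -
    have "(\<lambda>z. \<phi> z \<otimes>\<^bsub>D\<^esub> \<psi> z) \<in> hom (G\<lparr>carrier := Z\<rparr>) D"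
      using that unfolding carrier_\<H> by (intro homI) (auto simp: hom_def Pi_iff D.m_ac)
    then show ?thesis
      using subgroup.m_closed[OF Z_subgroup] by (auto simp: carrier_\<H> mult_\<H> hom_def Pi_iff)
  qed
  have hom: "\<chi> \<in> hom \<H> (H2 G D)"
  proof (rule homI)
    fix \<phi> assume "\<phi> \<in> carrier \<H>"
    then show "\<chi> \<phi> \<in> carrier (H2 G D)"
      using E transgression_cocycle by (auto simp: carrier_H2 \<chi>_def)
  next
    fix \<phi> \<psi> assume \<phi>\<psi>: "\<phi> \<in> carrier \<H>" "\<psi> \<in> carrier \<H>"
    \<comment> \<open>\<open>E\<close> itself need not be multiplicative; it suffices that the
      product of the chosen extensions is some extension of the product.\<close>
    have "\<chi> (\<phi> \<otimes>\<^bsub>\<H>\<^esub> \<psi>) = cohomology_class (transgression (\<lambda>a. E \<phi> a \<otimes>\<^bsub>D\<^esub> E \<psi> a))"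
      using mult_closed[OF \<phi>\<psi>] \<phi>\<psi> by (intro \<chi>_eqI HomA_lambda_mult E) (simp_all add: mult_\<H> E_Z)
    also have "\<dots> = \<chi> \<phi> \<otimes>\<^bsub>H2 G D\<^esub> \<chi> \<psi>"
      using \<phi>\<psi> E transgression_cocycle by (simp add: \<chi>_def transgression_mult cohomology_class_mult)
    finally show "\<chi> (\<phi> \<otimes>\<^bsub>\<H>\<^esub> \<psi>) = \<chi> \<phi> \<otimes>\<^bsub>H2 G D\<^esub> \<chi> \<psi>" .
  qed
  have inj: "inj_on \<chi> (carrier \<H>)"
  proof (rule inj_onI)
    fix \<phi> \<psi> assume \<phi>\<psi>: "\<phi> \<in> carrier \<H>" "\<psi> \<in> carrier \<H>" and eq: "\<chi> \<phi> = \<chi> \<psi>"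
    have "\<phi> z = \<psi> z" if "z \<in> Z" for z
      using transgression_class_eq_iff[OF E[OF \<phi>\<psi>(1)] E[OF \<phi>\<psi>(2)] assms(7)] eq that E_Z \<phi>\<psi>
      by (auto simp: \<chi>_def)
    then show "\<phi> = \<psi>" using \<phi>\<psi> by (auto simp: carrier_\<H> intro: extensionalityI)
  qed
  have img: "\<chi> ` carrier \<H> = \<N>"
  proof (intro equalityI subsetI)
    fix \<xi> assume "\<xi> \<in> \<chi> ` carrier \<H>"
    then show "\<xi> \<in> \<N>"
      using E theta'_transgression transgression_cocycle by (auto simp: \<N>_def kernel_def carrier_H2 \<chi>_def)
  next
    fix \<xi> assume "\<xi> \<in> \<N>"
    then obtain f where f: "f \<in> cocycles2 G D" "\<xi> = cohomology_class f"
        "theta' G H K D (cohomology_class f) = \<one>\<^bsub>theta'_target G H K D\<^esub>"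
      by (auto simp: \<N>_def kernel_def carrier_H2)
    then obtain \<Phi> where \<Phi>: "\<Phi> \<in> HomA" "\<xi> = cohomology_class (transgression \<Phi>)"
      using kernel_theta'_is_transgression by blast
    \<comment> \<open>The preimage is the restriction of \<Phi> to \<open>Z\<close>, for which
      \<Phi> is itself an admissible extension.\<close>
    have "restrict \<Phi> Z \<in> carrier \<H>"
      using \<Phi>(1) Z_subset_A subgroup.m_closed[OF Z_subgroup] by (auto simp: carrier_\<H> hom_def Pi_iff subset_iff)
    moreover from this have "\<chi> (restrict \<Phi> Z) = \<xi>"
      unfolding \<Phi>(2) by (intro \<chi>_eqI) (simp_all add: \<Phi>)
    ultimately show "\<xi> \<in> \<chi> ` carrier \<H>" by blast
  qed
  have "\<chi> \<in> iso \<H> ((H2 G D)\<lparr>carrier := \<N>\<rparr>)"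
    using hom inj img by (auto simp: iso_def bij_betw_def hom_def)
  then show ?thesis
    using hom inj img unfolding \<H>_def \<N>_def is_iso_def by blast
qed

end
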